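(* Let $\operatorname{Im}\tau>0$, $q=e^{2\pi i\tau}$, $y=e^{2\pi iz}$ with $z\notin\mathbb Z+\tau\mathbb Z$, and let $\zeta\in\mathbb C$ with $|q|<|\zeta|<|q|^{-1}$. Then $$ \frac1y\prod_{n=1}^\infty\frac{\left(1-\frac y\zeta q^{n-1}\right)\left(1-\frac\zeta y q^n\right)\left(1-\frac1{y\zeta}q^n\right)\left(1-y\zeta q^{n-1}\right)}{\left(1-\zeta q^n\right)^2\left(1-\frac1\zeta q^n\right)^2}=\sum_{N=0}^\infty\chi_N(\zeta)\,\mathscr F_N(\tau,z), $$ where $\chi_N(\zeta)=\sum_{i=0}^N\zeta^{2i-N}$ is the character of the $(N+1)$-dimensional irreducible representation of $SU(2)$ and $$ \mathscr F_N(\tau,z)=-\frac{\theta_1(\tau,z)}{\eta(\tau)^3}\left(s_N(\tau,z)-2s_{N+1}(\tau,z)+2s_{N+3}(\tau,z)-s_{N+4}(\tau,z)\right). $$ (The left-hand side is $\frac1y\mathrm{ch}(\mathbb E)$, where $\mathbb E$ is the bundle defining the elliptic genus of a K3 surface with tangent bundle $\mathcal T$, under the splitting $\mathrm{ch}(\mathcal T)=\zeta+\zeta^{-1}$; and $\chi_N(\zeta)=\mathrm{ch}(\mathcal S^N\mathcal T)$.)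
   Context: $\theta_1(\tau,z)=i q^{1/8}y^{-1/2}\prod_{n\ge1}(1-q^n)(1-q^{n-1}y)(1-q^ny^{-1})$ with $y^{1/2}=e^{\pi iz}$; $\eta(\tau)=q^{1/24}\prod_{n\ge1}(1-q^n)$; and for every integer $N\ge0$ $$s_N(\tau,z)=\frac{\theta_1(\tau,z)}{\eta(\tau)^3}\sum_{i\in\mathbb Z}\frac{1}{(1-yq^i)\left(1-\frac1yq^{N-1-i}\right)}.$$ Here the bundle in question is $\mathbb E=\bigotimes_{n\ge1}\Lambda_{-yq^{n-1}}\mathcal T\otimes\bigotimes_{n\ge1}\Lambda_{-y^{-1}q^n}\mathcal T^*\otimes\bigotimes_{n\ge1}\mathcal S_{q^n}\mathcal T\otimes\bigotimes_{n\ge1}\mathcal S_{q^n}\mathcal T^*$, with $\Lambda_t\mathcal E=\bigoplus_kt^k\Lambda^k\mathcal E$ and $\mathcal S_t\mathcal E=\bigoplus_{k\ge0}t^k\mathcal S^k\mathcal E$. *)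

theory Defs
  imports "HOL-Analysis.Analysis" "HOL-Library.Multiset"
begin

definition nome :: "complex \<Rightarrow> complex" where
  "nome \<tau> = exp (2 * of_real pi * \<i> * \<tau>)"

definition yvar :: "complex \<Rightarrow> complex" where
  "yvar z = exp (2 * of_real pi * \<i> * z)"

text \<open>
  Fractional powers are taken through the exponential:
  \<open>q\<^sup>1\<^sup>/\<^sup>8 = exp (2\<pi>i\<tau>/8)\<close>, \<open>q\<^sup>1\<^sup>/\<^sup>2\<^sup>4 = exp (2\<pi>i\<tau>/24)\<close> and
  \<open>y\<^sup>-\<^sup>1\<^sup>/\<^sup>2 = exp (- \<pi>iz)\<close>.
  Products over \<open>n \<ge> 1\<close> are indexed from \<open>0\<close>, with \<open>Suc n\<close> in the role of \<open>n\<close>.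
\<close>

definition theta1 :: "complex \<Rightarrow> complex \<Rightarrow> complex" where
  "theta1 \<tau> z =
     \<i> * exp (2 * of_real pi * \<i> * \<tau> / 8) * exp (- (of_real pi * \<i> * z)) *
     (\<Prod>n. (1 - nome \<tau> ^ Suc n) * (1 - nome \<tau> ^ n * yvar z) * (1 - nome \<tau> ^ Suc n / yvar z))"

definition dedekind_eta :: "complex \<Rightarrow> complex" where
  "dedekind_eta \<tau> = exp (2 * of_real pi * \<i> * \<tau> / 24) * (\<Prod>n. 1 - nome \<tau> ^ Suc n)"

definition s_fun :: "nat \<Rightarrow> complex \<Rightarrow> complex \<Rightarrow> complex" where
  "s_fun N \<tau> z =
     theta1 \<tau> z / dedekind_eta \<tau> ^ 3 *
     (\<Sum>\<^sub>\<infinity>i\<in>(UNIV :: int set).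
        1 / ((1 - yvar z * nome \<tau> powi i) *
             (1 - 1 / yvar z * nome \<tau> powi (int N - 1 - i))))"

definition F_fun :: "nat \<Rightarrow> complex \<Rightarrow> complex \<Rightarrow> complex" where
  "F_fun N \<tau> z =
     - (theta1 \<tau> z / dedekind_eta \<tau> ^ 3) *
     (s_fun N \<tau> z - 2 * s_fun (N + 1) \<tau> z + 2 * s_fun (N + 3) \<tau> z - s_fun (N + 4) \<tau> z)"

definition su2_char :: "nat \<Rightarrow> complex \<Rightarrow> complex" where
  "su2_char N \<zeta> = (\<Sum>i=0..N. \<zeta> powi (2 * int i - int N))"

text \<open>
  Chern characters under the splitting principle. A bundle enters through the finite family
  \<open>a j\<close>, \<open>j \<in> J\<close>, of the exponentials of its Chern roots, so that its Chern character is
  \<open>\<Sum>j\<in>J. a j\<close>. The roots of \<open>\<Lambda>\<^sup>k\<close> are the sums over \<open>k\<close>-element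
  subsets of \<open>J\<close>, those of \<open>S\<^sup>k\<close> the sums over \<open>k\<close>-element multisets; the dual bundle
  has the inverse exponentials, and \<open>ch\<close> is additive on direct sums and multiplicative on
  tensor products.
\<close>

definition ch_ext :: "nat \<Rightarrow> 'j set \<Rightarrow> ('j \<Rightarrow> complex) \<Rightarrow> complex" where
  "ch_ext k J a = (\<Sum>A | A \<subseteq> J \<and> card A = k. \<Prod>j\<in>A. a j)"

definition ch_sym :: "nat \<Rightarrow> 'j set \<Rightarrow> ('j \<Rightarrow> complex) \<Rightarrow> complex" where
  "ch_sym k J a = (\<Sum>M | set_mset M \<subseteq> J \<and> size M = k. \<Prod>j\<in>#M. a j)"

definition ch_Lambda :: "complex \<Rightarrow> 'j set \<Rightarrow> ('j \<Rightarrow> complex) \<Rightarrow> complex" where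
  "ch_Lambda t J a = (\<Sum>k\<le>card J. t ^ k * ch_ext k J a)"

definition ch_S :: "complex \<Rightarrow> 'j set \<Rightarrow> ('j \<Rightarrow> complex) \<Rightarrow> complex" where
  "ch_S t J a = (\<Sum>k. t ^ k * ch_sym k J a)"

definition ch_E :: "complex \<Rightarrow> complex \<Rightarrow> 'j set \<Rightarrow> ('j \<Rightarrow> complex) \<Rightarrow> complex" where
  "ch_E \<tau> z J a =
     (\<Prod>n. ch_Lambda (- yvar z * nome \<tau> ^ n) J a) *
     (\<Prod>n. ch_Lambda (- (1 / yvar z) * nome \<tau> ^ Suc n) J (\<lambda>j. inverse (a j))) *
     (\<Prod>n. ch_S (nome \<tau> ^ Suc n) J a) *
     (\<Prod>n. ch_S (nome \<tau> ^ Suc n) J (\<lambda>j. inverse (a j)))"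

text \<open>The splitting \<open>ch(T) = \<zeta> + \<zeta>\<^sup>-\<^sup>1\<close> of a rank two bundle; the roots are indexed by \<open>bool\<close>.\<close>

definition split_roots :: "complex \<Rightarrow> bool \<Rightarrow> complex" where
  "split_roots \<zeta> b = (if b then \<zeta> else inverse \<zeta>)"

end

theory Submission
  imports Defs "HOL-Complex_Analysis.Complex_Analysis"
begin

text \<open>
  Write \<open>P(x) = \<Sum>\<^sub>i x q\<^sup>i / (1 - x q\<^sup>i)\<^sup>2\<close> over all integers \<open>i\<close>. Partial fractions and telescoping
  give \<open>(N - 1) / (1 - q\<^sup>N\<^sup>-\<^sup>1)\<close> for the sum in \<open>s\<^sub>N\<close> when \<open>N \<noteq> 1\<close>, whereas for \<open>N = 1\<close> it is
  \<open>- P(y)\<close>. Summation by parts then turns the right-hand side of the theorem, up to the theta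
  factor, into \<open>(1 - \<zeta>)\<^sup>2 / \<zeta> * (P(\<zeta>) - P(y))\<close> by the Lambert expansion of \<open>P\<close> on
  \<open>|q| < |\<zeta>| < 1 / |q|\<close>. The theorem becomes the multiplicative form of the Weierstrass identity
  \<open>\<sigma>(u + v) \<sigma>(u - v) / (\<sigma>(u)\<^sup>2 \<sigma>(v)\<^sup>2) = \<wp>(v) - \<wp>(u)\<close>, which is proved with the maximum
  principle on this annulus.
\<close>

subsection \<open>Summation\<close>

text \<open>Induction on \<open>k\<close>: termwise differentiation keeps the disc of convergence,
  and multiplying the derived series by \<open>x\<close> raises the power of \<open>n\<close> by
  one.\<close>

lemma summable_power_mult_geometric:
  fixes x :: "'a :: {real_normed_field, banach}"
  assumes "norm x < 1"
  shows "summable (\<lambda>n. of_nat n ^ k * x ^ n)"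
  using assms
proof (induction k arbitrary: x)
  case (Suc k)
  have "summable (\<lambda>n. diffs (\<lambda>n. of_nat n ^ k) n * x ^ n)"
    using Suc by (intro termdiff_converges[where K = 1])
  then have "summable (\<lambda>n. x * (diffs (\<lambda>n. of_nat n ^ k) n * x ^ n))"
    by (rule summable_mult)
  then have "summable (\<lambda>n. of_nat (Suc n) ^ Suc k * x ^ Suc n)"
    by (simp add: diffs_def mult_ac)
  then show ?case
    by (subst (asm) summable_Suc_iff)
qed (simp add: summable_geometric)

text \<open>Absolute convergence turns the two ordinary series into unordered sums; the negative
  half starts at -1, so the two index sets are disjoint.\<close>

lemma has_sum_int_splitI:
  fixes f :: "int \<Rightarrow> 'a :: banach"
  assumes "(\<lambda>n. f (int n)) sums a" "summable (\<lambda>n. norm (f (int n)))"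
    and "(\<lambda>n. f (- int (Suc n))) sums b" "summable (\<lambda>n. norm (f (- int (Suc n))))"
  shows "(f has_sum (a + b)) UNIV"
proof -
  have "((f \<circ> int) has_sum a) UNIV" "((f \<circ> (\<lambda>n. - int (Suc n))) has_sum b) UNIV"
    unfolding o_def using assms by (intro norm_summable_imp_has_sum; simp)+
  then have "(f has_sum a) (range int)" "(f has_sum b) (range (\<lambda>n. - int (Suc n)))"
    by (subst has_sum_reindex; simp add: inj_on_def)+
  then have "(f has_sum (a + b)) (range int \<union> range (\<lambda>n. - int (Suc n)))"
    by (rule has_sum_Un_disjoint) auto
  also have "range int \<union> range (\<lambda>n. - int (Suc n)) = UNIV"
  proof (intro equalityI subset_UNIV subsetI)
    fix k :: int
    show "k \<in> range int \<union> range (\<lambda>n. - int (Suc n))"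
      by (cases k rule: int_cases) simp_all
  qed
  finally show ?thesis .
qed

subsection \<open>Characters\<close>

lemma su2_char_conv_powers:
  assumes "\<zeta> \<noteq> 0"
  shows "su2_char N \<zeta> = (\<Sum>i\<le>N. \<zeta> ^ i * (1 / \<zeta>) ^ (N - i))"
  unfolding su2_char_def atLeast0AtMost
proof (rule sum.cong[OF refl])
  fix i assume "i \<in> {..N}"
  then have "2 * int i - int N = int i - int (N - i)"
    by simp
  then have "\<zeta> powi (2 * int i - int N) = \<zeta> powi int i / \<zeta> powi int (N - i)"
    using assms by (metis power_int_diff)
  then show "\<zeta> powi (2 * int i - int N) = \<zeta> ^ i * (1 / \<zeta>) ^ (N - i)"
    by (simp add: divide_inverse power_inverse)
qed

text \<open>The highest and lowest weights split off, and the interior weights are those of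
  \<open>su2_char N\<close>.\<close>

lemma su2_char_Suc_Suc:
  assumes "\<zeta> \<noteq> 0"
  shows "su2_char (Suc (Suc N)) \<zeta> = su2_char N \<zeta> + \<zeta> ^ Suc (Suc N) + (1 / \<zeta>) ^ Suc (Suc N)"
proof -
  have "su2_char (Suc (Suc N)) \<zeta> =
      (\<Sum>i\<le>Suc N. \<zeta> ^ i * (1 / \<zeta>) ^ (Suc (Suc N) - i)) + \<zeta> ^ Suc (Suc N)"
    by (simp add: su2_char_conv_powers[OF assms] del: power_Suc)
  also have "(\<Sum>i\<le>Suc N. \<zeta> ^ i * (1 / \<zeta>) ^ (Suc (Suc N) - i)) =
      (1 / \<zeta>) ^ Suc (Suc N) + (\<Sum>i\<le>N. \<zeta> ^ Suc i * (1 / \<zeta>) ^ (Suc N - i))"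
    by (subst sum.atMost_Suc_shift) (simp del: power_Suc)
  also have "(\<Sum>i\<le>N. \<zeta> ^ Suc i * (1 / \<zeta>) ^ (Suc N - i)) = su2_char N \<zeta>"
    unfolding su2_char_conv_powers[OF assms]
    by (rule sum.cong) (use assms in \<open>auto simp: Suc_diff_le\<close>)
  finally show ?thesis
    by simp
qed

lemma su2_char_0: "su2_char 0 \<zeta> = 1"
  by (simp add: su2_char_def)

lemma su2_char_1: "\<zeta> \<noteq> 0 \<Longrightarrow> su2_char (Suc 0) \<zeta> = \<zeta> + 1 / \<zeta>"
  by (simp add: su2_char_conv_powers)

lemma norm_su2_char_le:
  assumes "\<zeta> \<noteq> 0" "norm \<zeta> \<le> R" "norm (1 / \<zeta>) \<le> R"
  shows "norm (su2_char N \<zeta>) \<le> real (Suc N) * R ^ N"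
proof -
  have "norm (\<zeta> ^ i * (1 / \<zeta>) ^ (N - i)) \<le> R ^ N" if "i \<le> N" for i
  proof -
    have "norm \<zeta> ^ i * norm (1 / \<zeta>) ^ (N - i) \<le> R ^ i * R ^ (N - i)"
      using assms order_trans[OF norm_ge_zero assms(2)]
      by (intro mult_mono power_mono zero_le_power norm_ge_zero)
    also have "\<dots> = R ^ N"
      using that by (simp flip: power_add)
    finally show ?thesis
      by (simp add: norm_mult norm_power)
  qed
  then have "norm (\<Sum>i\<le>N. \<zeta> ^ i * (1 / \<zeta>) ^ (N - i)) \<le> of_nat (card {..N}) * R ^ N"
    by (intro sum_norm_bound) auto
  then show ?thesis
    by (simp add: su2_char_conv_powers[OF assms(1)])
qed

text \<open>By \<open>su2_char_Suc_Suc\<close> only the weights \<open>m + 2\<close>,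
  \<open>m + 3\<close>, \<open>m + 4\<close> and their negatives survive, with coefficients 1, -2,
  1; this is multiplication by \<open>\<zeta> + 1 / \<zeta> - 2\<close>. The left side is the
  coefficient that \<open>ssum y (m + 4)\<close> acquires in the summation by parts.\<close>

lemma su2_char_combination:
  assumes "\<zeta> \<noteq> 0"
  shows "su2_char (m + 4) \<zeta> - 2 * su2_char (m + 3) \<zeta> + 2 * su2_char (m + 1) \<zeta> - su2_char m \<zeta> =
    (1 - \<zeta>)\<^sup>2 / \<zeta> * (\<zeta> ^ (m + 3) + (1 / \<zeta>) ^ (m + 3))"
proof -
  have *: "(1 - \<zeta>)\<^sup>2 / \<zeta> = \<zeta> + 1 / \<zeta> - 2"
    using assms by (simp add: field_simps power2_eq_square)
  have "su2_char (m + 4) \<zeta> = su2_char m \<zeta> + \<zeta> ^ (m + 2) + (1 / \<zeta>) ^ (m + 2) + \<zeta> ^ (m + 4) + (1 / \<zeta>) ^ (m + 4)"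
    using su2_char_Suc_Suc[OF assms, of "m + 2"] su2_char_Suc_Suc[OF assms, of m]
    by (simp add: numeral_eq_Suc del: power_Suc)
  moreover have "su2_char (m + 3) \<zeta> = su2_char (m + 1) \<zeta> + \<zeta> ^ (m + 3) + (1 / \<zeta>) ^ (m + 3)"
    using su2_char_Suc_Suc[OF assms, of "m + 1"] by (simp add: numeral_eq_Suc del: power_Suc)
  moreover have "\<zeta> ^ (m + 4) = \<zeta> * \<zeta> ^ (m + 3)" "(1 / \<zeta>) ^ (m + 4) = 1 / \<zeta> * (1 / \<zeta>) ^ (m + 3)"
    "\<zeta> ^ (m + 2) = 1 / \<zeta> * \<zeta> ^ (m + 3)" "(1 / \<zeta>) ^ (m + 2) = \<zeta> * (1 / \<zeta>) ^ (m + 3)"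
    using assms by (simp_all add: numeral_eq_Suc)
  ultimately show ?thesis
    unfolding * by (simp add: algebra_simps)
qed

section \<open>Chern characters of the split rank two bundle\<close>

lemma mset_bool_eq: "M = replicate_mset (count M True) True + replicate_mset (count M False) False"
proof (rule multiset_eqI)
  show "count M b = count (replicate_mset (count M True) True + replicate_mset (count M False) False) b" for b
    by (cases b) auto
qed

text \<open>A multiset of size \<open>k\<close> over two roots is determined by the multiplicity
  \<open>i\<close> of \<open>True\<close>, and it contributes
  \<open>\<zeta> ^ i * (1 / \<zeta>) ^ (k - i)\<close>.\<close>

lemma ch_sym_split_roots:
  assumes "\<zeta> \<noteq> 0"
  shows "ch_sym k UNIV (split_roots \<zeta>) = su2_char k \<zeta>"
proof -
  define h where "h i = replicate_mset i True + replicate_mset (k - i) False" for i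
  have "bij_betw h {..k} {M. set_mset M \<subseteq> UNIV \<and> size M = k}"
  proof (rule bij_betwI[where g = "\<lambda>M. count M True"])
    have size: "size M = count M True + count M False" for M :: "bool multiset"
      using arg_cong[OF mset_bool_eq, of size M] by simp
    then show "(\<lambda>M. count M True) \<in> {M. set_mset M \<subseteq> UNIV \<and> size M = k} \<rightarrow> {..k}"
      by auto
    show "h (count M True) = M" if "M \<in> {M. set_mset M \<subseteq> UNIV \<and> size M = k}" for M
    proof -
      have "k - count M True = count M False"
        using that size[of M] by simp
      then show ?thesis
        unfolding h_def using mset_bool_eq[of M] by simp
    qed
  qed (auto simp: h_def)
  then have "ch_sym k UNIV (split_roots \<zeta>) = (\<Sum>i\<le>k. \<Prod>j\<in>#h i. split_roots \<zeta> j)"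
    unfolding ch_sym_def by (rule sum.reindex_bij_betw[symmetric])
  also have "\<dots> = su2_char k \<zeta>"
    unfolding su2_char_conv_powers[OF assms]
    by (simp add: h_def split_roots_def inverse_eq_divide)
  finally show ?thesis .
qed

text \<open>Only subsets of size 0, 1, 2 contribute, and the top exterior power is trivial because
  the two roots are inverse to each other.\<close>

lemma ch_Lambda_split_roots:
  assumes "\<zeta> \<noteq> 0"
  shows "ch_Lambda t UNIV (split_roots \<zeta>) = (1 + t * \<zeta>) * (1 + t / \<zeta>)"
proof -
  have sets: "{A :: bool set. A \<subseteq> UNIV \<and> card A = 0} = {{}}"
    "{A :: bool set. A \<subseteq> UNIV \<and> card A = 1} = {{True}, {False}}"
    "{A :: bool set. A \<subseteq> UNIV \<and> card A = 2} = {UNIV}"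
  proof -
    show "{A :: bool set. A \<subseteq> UNIV \<and> card A = 0} = {{}}"
      by simp
    have "card A = 1 \<longleftrightarrow> A = {True} \<or> A = {False}" for A :: "bool set"
      by (simp add: card_1_singleton_iff ex_bool_eq)
    then show "{A :: bool set. A \<subseteq> UNIV \<and> card A = 1} = {{True}, {False}}"
      by blast
    have "card A = 2 \<longleftrightarrow> A = UNIV" for A :: "bool set"
      using card_eq_UNIV_imp_eq_UNIV[of A] by auto
    then show "{A :: bool set. A \<subseteq> UNIV \<and> card A = 2} = {UNIV}"
      by blast
  qed
  have "{..2} = {0, 1, 2 :: nat}"
    by auto
  then have "ch_Lambda t UNIV (split_roots \<zeta>) =
      ch_ext 0 UNIV (split_roots \<zeta>) + t * ch_ext 1 UNIV (split_roots \<zeta>) + t\<^sup>2 * ch_ext 2 UNIV (split_roots \<zeta>)"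
    unfolding ch_Lambda_def by (simp add: add.assoc)
  also have "\<dots> = 1 + t * (\<zeta> + 1 / \<zeta>) + t\<^sup>2 * (\<zeta> * (1 / \<zeta>))"
    unfolding ch_ext_def sets by (simp add: split_roots_def UNIV_bool inverse_eq_divide)
  finally show ?thesis
    by (simp add: algebra_simps power2_eq_square)
qed

text \<open>The generating series of the characters is the Cauchy product of the geometric series of
  the two roots; the norm bounds are their convergence conditions.\<close>

lemma ch_S_split_roots:
  assumes "\<zeta> \<noteq> 0" "norm (t * \<zeta>) < 1" "norm (t / \<zeta>) < 1"
  shows "ch_S t UNIV (split_roots \<zeta>) = 1 / ((1 - t * \<zeta>) * (1 - t / \<zeta>))"
proof -
  have "(\<lambda>k. \<Sum>i\<le>k. (t * \<zeta>) ^ i * (t / \<zeta>) ^ (k - i)) sums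
      ((\<Sum>k. (t * \<zeta>) ^ k) * (\<Sum>k. (t / \<zeta>) ^ k))"
    using assms(2,3) by (intro Cauchy_product_sums) (simp_all add: norm_power summable_geometric)
  moreover have "(\<Sum>i\<le>k. (t * \<zeta>) ^ i * (t / \<zeta>) ^ (k - i)) = t ^ k * ch_sym k UNIV (split_roots \<zeta>)" for k
  proof -
    have "(t * \<zeta>) ^ i * (t / \<zeta>) ^ (k - i) = t ^ k * (\<zeta> ^ i * (1 / \<zeta>) ^ (k - i))" if "i \<le> k" for i
    proof -
      have "t ^ k = t ^ i * t ^ (k - i)"
        using that by (simp flip: power_add)
      then show ?thesis
        by (simp add: power_mult_distrib power_divide)
    qed
    then show ?thesis
      unfolding ch_sym_split_roots[OF assms(1)] su2_char_conv_powers[OF assms(1)] sum_distrib_left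
      by (intro sum.cong) auto
  qed
  ultimately have "ch_S t UNIV (split_roots \<zeta>) = (\<Sum>k. (t * \<zeta>) ^ k) * (\<Sum>k. (t / \<zeta>) ^ k)"
    unfolding ch_S_def by (simp add: sums_iff)
  then show ?thesis
    using assms(2,3) by (simp add: suminf_geometric)
qed

lemma split_roots_dual: "(\<lambda>j. inverse (split_roots \<zeta> j)) = split_roots (1 / \<zeta>)"
  by (auto simp: split_roots_def inverse_eq_divide)

text \<open>The analysis depends on \<open>\<tau>\<close> only through the nome, so it is done for
  any \<open>q\<close> in the punctured unit disc; \<open>\<tau>\<close> returns when
  \<open>ch_E\<close> and \<open>F_fun\<close> are rewritten.\<close>

locale nome_disc =
  fixes q :: complex
  assumes q_nz: "q \<noteq> 0" and norm_q: "norm q < 1"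
begin

subsection \<open>The theta product\<close>

text \<open>The infinite q-Pochhammer symbol.\<close>

definition qpoch :: "complex \<Rightarrow> complex" where
  "qpoch x = (\<Prod>n. 1 - x * q ^ n)"

text \<open>Jacobi's theta function in the multiplicative variable, stripped of the exponential
  prefactor and of the factor \<open>qpoch q\<close> that \<open>theta1\<close> carries.\<close>

definition theta :: "complex \<Rightarrow> complex" where
  "theta x = qpoch x * qpoch (q / x)"

lemma q_pow_ne_1: "q ^ Suc n \<noteq> 1"
proof
  assume "q ^ Suc n = 1"
  then have "norm q ^ Suc n = 1"
    by (metis norm_one norm_power)
  moreover have "norm q ^ Suc n < 1"
    by (rule power_Suc_less_one) (use norm_q q_nz in auto)
  ultimately show False by simp
qed

lemma qpoch_convergent: "convergent_prod (\<lambda>n. 1 - x * q ^ n)"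
proof (intro abs_convergent_prod_imp_convergent_prod summable_imp_abs_convergent_prod)
  have "summable (\<lambda>n. norm x * norm q ^ n)"
    using norm_q by (intro summable_mult summable_geometric) auto
  then show "summable (\<lambda>n. norm (1 - x * q ^ n - 1))"
    by (simp add: norm_mult norm_power)
qed

lemma qpoch_has_prod: "(\<lambda>n. 1 - x * q ^ n) has_prod qpoch x"
  unfolding qpoch_def using qpoch_convergent by (rule convergent_prod_has_prod)

lemma qpoch_eq_0_iff: "qpoch x = 0 \<longleftrightarrow> (\<exists>n. x * q ^ n = 1)"
proof -
  have "0 \<in> range (\<lambda>n. 1 - x * q ^ n) \<longleftrightarrow> (\<exists>n. x * q ^ n = 1)"
    by (auto simp: image_iff)
  then show ?thesis
    using has_prod_eq_0_iff[OF qpoch_has_prod] by simp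
qed

lemma qpoch_nonzero: "norm x < 1 \<Longrightarrow> qpoch x \<noteq> 0"
proof
  assume x: "norm x < 1" and "qpoch x = 0"
  then obtain n where n: "x * q ^ n = 1"
    by (auto simp: qpoch_eq_0_iff)
  have "norm (x * q ^ n) \<le> norm x * 1"
    unfolding norm_mult norm_power using norm_q by (intro mult_left_mono power_le_one) auto
  with n x show False by simp
qed

lemma qpoch_shift: "qpoch x = (1 - x) * qpoch (x * q)"
proof (cases "x = 1")
  case True
  then have "qpoch x = 0"
    unfolding qpoch_eq_0_iff by (intro exI[of _ 0]) simp
  with True show ?thesis by simp
next
  case False
  have "(\<Prod>n. 1 - x * q ^ Suc n) = qpoch x / (1 - x * q ^ 0)"
    unfolding qpoch_def using False by (intro prodinf_split_head qpoch_convergent) auto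
  also have "(\<Prod>n. 1 - x * q ^ Suc n) = qpoch (x * q)"
    unfolding qpoch_def power_Suc mult.assoc ..
  finally show ?thesis
    using False by (simp add: field_simps)
qed

text \<open>The partial products converge uniformly on every closed disc of radius 1, by the M-test
  with majorant \<open>(norm x + 1) * norm q ^ n\<close>.\<close>

lemma qpoch_holomorphic: "qpoch holomorphic_on A"
proof (rule holomorphic_on_subset[where s = UNIV])
  show "qpoch holomorphic_on UNIV"
  proof (rule holomorphic_uniform_sequence)
    fix x :: complex
    have "uniformly_convergent_on (cball x 1) (\<lambda>N w. \<Prod>n<N. 1 + (- w * q ^ n))"
    proof (rule Complex_Transcendental.uniformly_convergent_on_prod)
      show "continuous_on (cball x 1) (\<lambda>w. - w * q ^ n)" for n
        by (intro continuous_intros)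
      show "uniformly_convergent_on (cball x 1) (\<lambda>N w. \<Sum>n<N. norm (- w * q ^ n))"
      proof (rule Weierstrass_m_test')
        show "norm (norm (- w * q ^ n)) \<le> (norm x + 1) * norm q ^ n" if "w \<in> cball x 1" for n w
        proof -
          have "norm w \<le> norm x + 1"
            using that norm_triangle_ineq2[of w x] by (simp add: dist_norm norm_minus_commute)
          then have "norm w * norm q ^ n \<le> (norm x + 1) * norm q ^ n"
            by (rule mult_right_mono) simp
          then show ?thesis
            by (simp add: norm_mult norm_power)
        qed
        show "summable (\<lambda>n. (norm x + 1) * norm q ^ n)"
          using norm_q by (intro summable_mult summable_geometric) auto
      qed
    qed (rule compact_cball)
    then have "uniformly_convergent_on (cball x 1) (\<lambda>N w. \<Prod>n<N. 1 - w * q ^ n)"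
      by simp
    then obtain g where g: "uniform_limit (cball x 1) (\<lambda>N w. \<Prod>n<N. 1 - w * q ^ n) g sequentially"
      by (auto simp: uniformly_convergent_on_def)
    have g_eq: "g w = qpoch w" if "w \<in> cball x 1" for w
    proof -
      have "(\<lambda>N. \<Prod>n<N. 1 - w * q ^ n) \<longlonglongrightarrow> qpoch w"
        using convergent_prod_LIMSEQ[OF qpoch_convergent[of w]] unfolding qpoch_def
        by (subst LIMSEQ_lessThan_iff_atMost)
      then show ?thesis
        by (rule LIMSEQ_unique[OF tendsto_uniform_limitI[OF g that]])
    qed
    have "uniform_limit (cball x 1) (\<lambda>N w. \<Prod>n<N. 1 - w * q ^ n) g sequentially \<longleftrightarrow>
        uniform_limit (cball x 1) (\<lambda>N w. \<Prod>n<N. 1 - w * q ^ n) qpoch sequentially"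
      by (rule uniform_limit_cong') (simp_all add: g_eq)
    with g have "uniform_limit (cball x 1) (\<lambda>N w. \<Prod>n<N. 1 - w * q ^ n) qpoch sequentially"
      by blast
    then show "\<exists>d>0. cball x d \<subseteq> UNIV \<and>
        uniform_limit (cball x d) (\<lambda>N w. \<Prod>n<N. 1 - w * q ^ n) qpoch sequentially"
      by (intro exI[of _ 1]) auto
  next
    show "(\<lambda>w. \<Prod>n<N. 1 - w * q ^ n) holomorphic_on UNIV" for N
      by (intro holomorphic_intros)
  qed simp
qed simp

lemma qpoch_holomorphic' [holomorphic_intros]:
  assumes "f holomorphic_on A"
  shows "(\<lambda>x. qpoch (f x)) holomorphic_on A"
  using holomorphic_on_compose[OF assms qpoch_holomorphic] unfolding o_def .

text \<open>Under the shift \<open>qpoch x\<close> loses the factor \<open>1 - x\<close> and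
  \<open>qpoch (q / x)\<close> gains \<open>1 - 1 / x\<close>, whose ratio is
  \<open>- 1 / x\<close>.\<close>

lemma theta_shift:
  assumes "x \<noteq> 0"
  shows "theta (q * x) = - theta x / x"
proof -
  have "qpoch (1 / x) = (1 - 1 / x) * qpoch (q / x)"
    using qpoch_shift[of "1 / x"] by simp
  moreover have "qpoch x = (1 - x) * qpoch (q * x)"
    using qpoch_shift[of x] by (simp add: mult.commute)
  moreover have "theta (q * x) = qpoch (q * x) * qpoch (1 / x)"
    unfolding theta_def using q_nz by simp
  \<comment> \<open>Multiplying by \<open>x\<close>, rather than dividing by \<open>1 - x\<close>,
    also covers \<open>x = 1\<close>.\<close>
  ultimately have "theta (q * x) * x = (1 - 1 / x) * x * (qpoch (q * x) * qpoch (q / x))"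
    by simp
  also have "(1 - 1 / x) * x = - (1 - x)"
    using assms by (simp add: field_simps)
  also have "\<dots> * (qpoch (q * x) * qpoch (q / x)) = - theta x"
    unfolding theta_def \<open>qpoch x = _\<close> by (simp add: algebra_simps)
  finally have "theta (q * x) * x = - theta x" .
  with assms show ?thesis
    by (simp add: field_simps)
qed

text \<open>The argument is an integral power of \<open>q\<close>: for \<open>k \<ge> 0\<close> the
  first factor of \<open>theta\<close> vanishes, for negative \<open>k\<close> the second.\<close>

lemma theta_eq_0:
  assumes "w \<noteq> 0" "x = w * q powi k"
  shows "theta (w / x) = 0"
proof -
  have wx: "w / x = q powi (- k)"
    using assms q_nz by (simp add: power_int_minus field_simps)
  show ?thesis
  proof (cases "k \<ge> 0")
    case True
    then have "w / x * q ^ nat k = 1"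
      unfolding wx using q_nz by (simp add: power_int_def power_inverse)
    then show ?thesis
      unfolding theta_def mult_eq_0_iff qpoch_eq_0_iff by blast
  next
    case False
    then have m: "- k = int (Suc (nat (- k - 1)))"
      by simp
    then have "w / x = q * q ^ nat (- k - 1)"
      unfolding wx by (metis m power_Suc power_int_of_nat)
    then have "q / (w / x) * q ^ nat (- k - 1) = 1"
      using q_nz by simp
    then show ?thesis
      unfolding theta_def mult_eq_0_iff qpoch_eq_0_iff by blast
  qed
qed

subsection \<open>The Lambert series\<close>

text \<open>At \<open>m = 0\<close> the denominator vanishes, but the value is 0, so the Lambert
  series has no constant term.\<close>

definition lcoeff :: "nat \<Rightarrow> complex" where
  "lcoeff m = of_nat m * q ^ m / (1 - q ^ m)"

definition lambert :: "complex \<Rightarrow> complex" where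
  "lambert x = (\<Sum>m. lcoeff m * x ^ m)"

text \<open>For positive \<open>m\<close> the denominator is at least \<open>1 - norm q\<close> in
  modulus; for \<open>m = 0\<close> both sides are 0.\<close>

lemma norm_lcoeff_le: "norm (lcoeff m) \<le> of_nat m * norm q ^ m / (1 - norm q)"
proof (cases m)
  case (Suc n)
  have "norm q ^ m \<le> norm q"
    unfolding Suc using norm_q by (simp add: mult_left_le power_le_one)
  then have "1 - norm q \<le> norm (1 - q ^ m)"
    using norm_triangle_ineq2[of 1 "q ^ m"] by (simp add: norm_power)
  with norm_q show ?thesis
    unfolding lcoeff_def norm_divide norm_mult norm_power norm_of_nat
    by (intro divide_left_mono mult_nonneg_nonneg mult_pos_pos) auto
qed (simp add: lcoeff_def)

lemma summable_lambert:
  assumes "norm (q * x) < 1"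
  shows "summable (\<lambda>m. norm (lcoeff m * x ^ m))"
proof (rule summable_comparison_test')
  show "summable (\<lambda>m. (real m ^ 1 * norm (q * x) ^ m) / (1 - norm q))"
    using assms by (intro summable_divide summable_power_mult_geometric) auto
  show "norm (norm (lcoeff m * x ^ m)) \<le> (real m ^ 1 * norm (q * x) ^ m) / (1 - norm q)" for m
    using mult_right_mono[OF norm_lcoeff_le, of "norm x ^ m" m]
    by (simp add: norm_mult norm_power power_mult_distrib mult_ac)
qed

lemma lambert_sums:
  assumes "norm (q * x) < 1"
  shows "(\<lambda>m. lcoeff m * x ^ m) sums lambert x"
  unfolding lambert_def using summable_lambert[OF assms, THEN summable_norm_cancel]
  by (rule summable_sums)

lemma lambert_holomorphic: "lambert holomorphic_on {x. norm (q * x) < 1}"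
proof -
  have *: "{x. norm (q * x) < 1} = ball 0 (1 / norm q)"
    using q_nz by (auto simp: norm_mult field_simps)
  show ?thesis
    unfolding *
  proof (rule power_series_holomorphic)
    fix w :: complex assume "w \<in> ball 0 (1 / norm q)"
    then have "norm (q * w) < 1"
      unfolding *[symmetric] by simp
    then show "(\<lambda>n. lcoeff n * (w - 0) ^ n) sums lambert w"
      using lambert_sums by simp
  qed
qed

text \<open>The factor \<open>1 - q ^ m\<close> produced by the shift cancels the denominator of
  \<open>lcoeff m\<close>, leaving the differentiated geometric series at
  \<open>q * x\<close>.\<close>

lemma lambert_shift:
  assumes "norm (q * x) < 1"
  shows "lambert x - lambert (q * x) = q * x / (1 - q * x)\<^sup>2"
proof -
  have "norm (q * (q * x)) \<le> 1 * norm (q * x)"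
    unfolding norm_mult[of q "q * x"] using norm_q by (intro mult_right_mono) auto
  then have qqx: "norm (q * (q * x)) < 1"
    using assms by simp
  have "(\<lambda>n. (q * x) * (of_nat (Suc n) * (q * x) ^ n)) sums ((q * x) * (1 / (1 - q * x)\<^sup>2))"
    by (intro sums_mult geometric_deriv_sums assms)
  then have "(\<lambda>n. of_nat (Suc n) * (q * x) ^ Suc n) sums (q * x / (1 - q * x)\<^sup>2)"
    by (simp add: mult_ac)
  then have "(\<lambda>n. of_nat n * (q * x) ^ n) sums (q * x / (1 - q * x)\<^sup>2)"
    by (subst (asm) sums_Suc_iff) simp
  moreover have "(\<lambda>m. lcoeff m * x ^ m - lcoeff m * (q * x) ^ m) sums (lambert x - lambert (q * x))"
    by (intro sums_diff lambert_sums assms qqx)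
  moreover have "lcoeff m * x ^ m - lcoeff m * (q * x) ^ m = of_nat m * (q * x) ^ m" for m
  proof (cases m)
    case (Suc n)
    have "lcoeff m * x ^ m - lcoeff m * (q * x) ^ m = lcoeff m * (1 - q ^ m) * x ^ m"
      by (simp add: power_mult_distrib algebra_simps)
    also have "lcoeff m * (1 - q ^ m) = of_nat m * q ^ m"
      unfolding lcoeff_def Suc using q_pow_ne_1[of n] by simp
    finally show ?thesis
      by (simp add: power_mult_distrib)
  qed simp
  ultimately show ?thesis
    by (simp add: sums_unique2)
qed

lemma norm_q_pow_mult_le: "norm (q ^ n * x) \<le> norm x"
  unfolding norm_mult norm_power using norm_q by (intro mult_left_le_one_le power_le_one) auto

text \<open>Telescoping of \<open>lambert_shift\<close> along \<open>q ^ n * x\<close>; the limit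
  term is \<open>lambert 0 = 0\<close> by continuity.\<close>

lemma lambert_partial_fractions:
  assumes "norm (q * x) < 1"
  shows "(\<lambda>n. x * q ^ Suc n / (1 - x * q ^ Suc n)\<^sup>2) sums lambert x"
proof -
  have small: "norm (q * (q ^ n * x)) < 1" for n
    using norm_q_pow_mult_le[of n "q * x"] assms by (simp add: mult_ac)
  have "isCont lambert 0"
  proof (rule continuous_on_interior)
    show "continuous_on {x. norm (q * x) < 1} lambert"
      by (intro holomorphic_on_imp_continuous_on lambert_holomorphic)
    have "open {x. norm (q * x) < 1}"
      by (intro open_Collect_less continuous_intros)
    then show "0 \<in> interior {x. norm (q * x) < 1}"
      by (simp add: interior_open)
  qed
  moreover have "(\<lambda>n. q ^ n * x) \<longlonglongrightarrow> 0 * x"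
    using norm_q by (intro tendsto_mult tendsto_const LIMSEQ_power_zero)
  ultimately have "(\<lambda>n. lambert (q ^ n * x)) \<longlonglongrightarrow> lambert 0"
    using isCont_tendsto_compose[of 0 lambert "\<lambda>n. q ^ n * x"] by simp
  moreover have "lambert 0 = 0"
    unfolding lambert_def using powser_zero[of lcoeff] by (simp add: lcoeff_def)
  ultimately have "(\<lambda>n. lambert (q ^ n * x) - lambert (q ^ Suc n * x)) sums (lambert (q ^ 0 * x) - 0)"
    by (intro telescope_sums') simp
  moreover have "lambert (q ^ n * x) - lambert (q ^ Suc n * x) = x * q ^ Suc n / (1 - x * q ^ Suc n)\<^sup>2" for n
    using lambert_shift[OF small[of n]] by (simp add: mult_ac)
  ultimately show ?thesis
    by simp
qed

subsection \<open>Bilateral sums\<close>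

text \<open>Once \<open>norm (x * q ^ n) < 1 / 2\<close> the denominators stay away from 0. The
  finitely many earlier terms are harmless, a zero denominator giving the value 0.\<close>

lemma
  shows summable_geometric_fraction: "summable (\<lambda>n. norm (x * q ^ n / (1 - x * q ^ n)))"
    and summable_geometric_fraction2: "summable (\<lambda>n. norm (x * q ^ n / (1 - x * q ^ n)\<^sup>2))"
proof -
  have lim: "(\<lambda>n. x * q ^ n) \<longlonglongrightarrow> x * 0"
    using norm_q by (intro tendsto_mult tendsto_const LIMSEQ_power_zero)
  have ev: "eventually (\<lambda>n. norm (x * q ^ n) < 1 / 2) sequentially"
    using order_tendstoD(2)[OF tendsto_norm[OF lim], of "1 / 2"] by simp
  have lower: "1 / 2 \<le> norm (1 - a)" if "norm a < 1 / 2" for a :: complex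
    using norm_triangle_ineq2[of 1 a] that by simp
  have sm: "summable (\<lambda>n. c * norm (x * q ^ n))" for c :: real
    unfolding norm_mult norm_power using norm_q by (intro summable_mult summable_geometric) auto
  show "summable (\<lambda>n. norm (x * q ^ n / (1 - x * q ^ n)))"
  proof (rule summable_comparison_test_ev[OF _ sm[of 2]], rule eventually_mono[OF ev])
    fix n assume n: "norm (x * q ^ n) < 1 / 2"
    have "norm (x * q ^ n) / norm (1 - x * q ^ n) \<le> norm (x * q ^ n) / (1 / 2)"
      using lower[OF n] by (intro divide_left_mono) auto
    then show "norm (norm (x * q ^ n / (1 - x * q ^ n))) \<le> 2 * norm (x * q ^ n)"
      by (simp add: norm_divide)
  qed
  show "summable (\<lambda>n. norm (x * q ^ n / (1 - x * q ^ n)\<^sup>2))"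
  proof (rule summable_comparison_test_ev[OF _ sm[of 4]], rule eventually_mono[OF ev])
    fix n assume n: "norm (x * q ^ n) < 1 / 2"
    have "(1 / 2)\<^sup>2 \<le> (norm (1 - x * q ^ n))\<^sup>2"
      using lower[OF n] by (intro power_mono) auto
    moreover have "0 < norm (1 - x * q ^ n)"
      using lower[OF n] by linarith
    ultimately have "norm (x * q ^ n) / (norm (1 - x * q ^ n))\<^sup>2 \<le> norm (x * q ^ n) / (1 / 2)\<^sup>2"
      by (intro divide_left_mono) auto
    then show "norm (norm (x * q ^ n / (1 - x * q ^ n)\<^sup>2)) \<le> 4 * norm (x * q ^ n)"
      by (simp add: norm_divide norm_power power_divide)
  qed
qed

text \<open>The Weierstrass function in the multiplicative variable, up to scaling and an additive
  constant, in the form of its Lambert expansion on the annulus.\<close>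

definition wp :: "complex \<Rightarrow> complex" where
  "wp x = x / (1 - x)\<^sup>2 + lambert x + lambert (1 / x)"

text \<open>Since \<open>u / (1 - u)\<^sup>2\<close> is invariant under inversion of
  \<open>u\<close>, the negative indices form the Lambert series of \<open>1 / x\<close>.\<close>

lemma wp_has_sum:
  assumes x: "norm (q * x) < 1" "norm (q / x) < 1" and x0: "x \<noteq> 0"
  shows "((\<lambda>i. x * q powi i / (1 - x * q powi i)\<^sup>2) has_sum wp x) UNIV"
proof -
  have inv: "x * q powi (- int (Suc n)) / (1 - x * q powi (- int (Suc n)))\<^sup>2 =
      (1 / x) * q ^ Suc n / (1 - (1 / x) * q ^ Suc n)\<^sup>2" for n
  proof -
    have "u / (1 - u)\<^sup>2 = (1 / u) / (1 - 1 / u)\<^sup>2" if "u \<noteq> 0" for u :: complex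
    proof (cases "u = 1")
      case False
      with that show ?thesis
        by (simp add: field_simps power2_eq_square)
    qed simp
    moreover define v where "v = 1 / x * q ^ Suc n"
    moreover have v: "v \<noteq> 0" "x * q powi (- int (Suc n)) = 1 / v"
      unfolding v_def power_int_minus power_int_of_nat using x0 q_nz by (simp_all add: field_simps)
    ultimately show ?thesis
      unfolding v(2) v_def[symmetric] by metis
  qed
  have "((\<lambda>i. x * q powi i / (1 - x * q powi i)\<^sup>2) has_sum (x / (1 - x)\<^sup>2 + lambert x) + lambert (1 / x)) UNIV"
  proof (rule has_sum_int_splitI)
    have "(\<lambda>n. x * q ^ n / (1 - x * q ^ n)\<^sup>2) sums (lambert x + x * q ^ 0 / (1 - x * q ^ 0)\<^sup>2)"
      using lambert_partial_fractions[OF x(1)] by (subst (asm) sums_Suc_iff) simp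
    then show "(\<lambda>n. x * q powi int n / (1 - x * q powi int n)\<^sup>2) sums (x / (1 - x)\<^sup>2 + lambert x)"
      by (simp add: add.commute)
    show "summable (\<lambda>n. norm (x * q powi int n / (1 - x * q powi int n)\<^sup>2))"
      using summable_geometric_fraction2[of x] by simp
    show "(\<lambda>n. x * q powi (- int (Suc n)) / (1 - x * q powi (- int (Suc n)))\<^sup>2) sums lambert (1 / x)"
      unfolding inv using x by (intro lambert_partial_fractions) simp
    show "summable (\<lambda>n. norm (x * q powi (- int (Suc n)) / (1 - x * q powi (- int (Suc n)))\<^sup>2))"
      unfolding inv by (rule summable_geometric_fraction2[THEN summable_Suc_iff[THEN iffD2]])
  qed
  then show ?thesis
    by (simp add: wp_def)
qed

lemma tendsto_geometric_fraction: "(\<lambda>n. x * q ^ n / (1 - x * q ^ n)) \<longlonglongrightarrow> 0"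
  using summable_geometric_fraction[THEN summable_norm_cancel] by (rule summable_LIMSEQ_zero)

text \<open>The terms \<open>f i\<close> tend to 1 as \<open>i\<close> grows and to 0 as
  \<open>i\<close> decreases, so each unit shift telescopes to 1; induction on \<open>k\<close> adds
  the shifts.\<close>

lemma has_sum_shift_difference:
  assumes y: "\<And>i. y * q powi i \<noteq> 1" and y0: "y \<noteq> 0"
  defines "f \<equiv> \<lambda>i. 1 / (1 - y * q powi i)"
  shows "((\<lambda>i. f (i + int k) - f i) has_sum of_nat k) UNIV"
proof (induction k)
  case (Suc k)
  \<comment> \<open>The decaying part of \<open>f\<close> at either end: \<open>f\<close> is
    \<open>1 + g y n\<close> at \<open>n\<close> and \<open>- g (1 / y) n\<close> at
    \<open>- n\<close>, so both half-sums telescope to limit 0.\<close>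
  define g where "g x n = x * q ^ n / (1 - x * q ^ n)" for x n
  have pos: "f (int n) = 1 + g y n" for n
    using y[of "int n"] by (simp add: f_def g_def field_simps)
  have neg: "f (- int n) = - g (1 / y) n" for n
  proof -
    define u where "u = 1 / y * q ^ n"
    have u: "u \<noteq> 0" "y * q powi (- int n) = 1 / u"
      unfolding u_def power_int_minus power_int_of_nat using y0 q_nz by (simp_all add: field_simps)
    with y[of "- int n"] have "u \<noteq> 1"
      by auto
    then show ?thesis
      unfolding f_def g_def u(2) u_def[symmetric] using u(1) by (simp add: field_simps)
  qed
  have sm: "summable (\<lambda>n. norm (g x (Suc n) - g x n))" for x
  proof (rule summable_comparison_test')
    show "summable (\<lambda>n. norm (g x (Suc n)) + norm (g x n))"
      unfolding g_def by (intro summable_add summable_geometric_fraction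
          summable_geometric_fraction[THEN summable_Suc_iff[THEN iffD2]])
  qed (use norm_triangle_ineq4 in auto)
  have tel: "(\<lambda>n. g x (Suc n) - g x n) sums (0 - g x 0)" for x
    by (rule telescope_sums) (simp add: g_def tendsto_geometric_fraction)
  have "((\<lambda>i. f (i + 1) - f i) has_sum (0 - g y 0) + (0 - g (1 / y) 0)) UNIV"
  proof (rule has_sum_int_splitI)
    have 1: "f (int n + 1) - f (int n) = g y (Suc n) - g y n" for n
      using pos[of "Suc n"] pos[of n] by (simp add: add.commute)
    show "(\<lambda>n. f (int n + 1) - f (int n)) sums (0 - g y 0)"
      "summable (\<lambda>n. norm (f (int n + 1) - f (int n)))"
      unfolding 1 by (rule tel sm)+
    have 2: "f (- int (Suc n) + 1) - f (- int (Suc n)) = g (1 / y) (Suc n) - g (1 / y) n" for n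
      using neg[of "Suc n"] neg[of n] by simp
    show "(\<lambda>n. f (- int (Suc n) + 1) - f (- int (Suc n))) sums (0 - g (1 / y) 0)"
      "summable (\<lambda>n. norm (f (- int (Suc n) + 1) - f (- int (Suc n))))"
      unfolding 2 by (rule tel sm)+
  qed
  \<comment> \<open>Both end expansions are valid at index 0; equating them gives the total.\<close>
  also have "(0 - g y 0) + (0 - g (1 / y) 0) = 1"
  proof -
    have "1 + g y 0 = - g (1 / y) 0"
      using pos[of 0] neg[of 0] by simp
    then show ?thesis
      by algebra
  qed
  finally have "((\<lambda>i. f (i + 1) - f i) has_sum 1) UNIV" .
  then have "((\<lambda>i. f (i + int k + 1) - f (i + int k)) has_sum 1) UNIV"
    by (subst has_sum_reindex_bij_betw[of "\<lambda>i. i + int k" UNIV UNIV "\<lambda>i. f (i + 1) - f i", symmetric, THEN sym])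
      (auto intro: bij_betwI[where g = "\<lambda>i. i - int k"])
  from has_sum_add[OF this Suc.IH] show ?case
    by (simp add: algebra_simps)
qed simp

subsection \<open>The Weierstrass identity\<close>

text \<open>Two periods of multiplication by \<open>q\<close>, which leaves room for a compact
  fundamental domain in the interior.\<close>

definition annulus :: "complex set" where
  "annulus = {w. norm q < norm w \<and> norm w < 1 / norm q}"

lemma annulus_D:
  assumes "w \<in> annulus"
  shows "w \<noteq> 0" "norm (q * w) < 1" "norm (q / w) < 1" "1 / w \<in> annulus"
proof -
  have w: "0 < norm w" "norm q < norm w" "norm q * norm w < 1"
    using assms q_nz unfolding annulus_def by (auto simp: field_simps intro: le_less_trans[of 0 "norm q"])
  then show "w \<noteq> 0" "norm (q * w) < 1" "norm (q / w) < 1" "1 / w \<in> annulus"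
    using q_nz unfolding annulus_def by (auto simp: norm_mult norm_divide divide_simps mult.commute)
qed

lemma open_annulus: "open annulus"
  unfolding annulus_def by (intro open_Collect_conj open_Collect_less continuous_intros)

lemma connected_annulus_q: "connected annulus"
  unfolding annulus_def using connected_annulus(1)[of "norm q" "0 :: complex" "1 / norm q"] by simp

lemma one_in_annulus: "1 \<in> annulus"
  unfolding annulus_def using norm_q q_nz by (auto simp: field_simps)

text \<open>The maximum of the modulus over a compact fundamental domain is a maximum over the whole
  open annulus, so the maximum principle applies. Periodicity is assumed exactly where
  \<open>w\<close> and \<open>q * w\<close> both lie in the annulus.\<close>

lemma annulus_periodic_constant:
  assumes hol: "f holomorphic_on annulus"
    and per: "\<And>w. 1 < norm w \<Longrightarrow> norm (q * w) < 1 \<Longrightarrow> f (q * w) = f w"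
  shows "f constant_on annulus"
proof -
  \<comment> \<open>With this radius the closed annulus \<open>K\<close> between \<open>r\<close>
    and \<open>1 / r\<close> has radius ratio \<open>1 / norm q\<close>, one full period.\<close>
  define r where "r = sqrt (norm q)"
  have r: "0 < r" "r < 1" "norm q = r * r"
    using q_nz norm_q by (auto simp: r_def)
  have rr: "r * r < r"
    using r by simp
  have r1: "1 < 1 / r" "1 / r < 1 / (r * r)"
    using r rr by (auto simp: field_simps)
  define K :: "complex set" where "K = cball 0 (1 / r) - ball 0 r"
  have K_iff: "w \<in> K \<longleftrightarrow> r \<le> norm w \<and> norm w \<le> 1 / r" for w
    by (auto simp: K_def)
  have sub: "K \<subseteq> annulus"
  proof
    fix w assume "w \<in> K"
    then have "r * r < norm w" "norm w < 1 / (r * r)"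
      using rr r1 unfolding K_iff by linarith+
    then show "w \<in> annulus"
      using r by (simp add: annulus_def)
  qed
  have "compact K"
    unfolding K_def by (intro compact_diff compact_cball open_ball)
  moreover have "1 \<in> K"
    using r r1 by (simp add: K_iff)
  moreover have "continuous_on K (\<lambda>w. norm (f w))"
    using hol sub by (intro continuous_on_norm holomorphic_on_imp_continuous_on)
      (rule holomorphic_on_subset)
  ultimately obtain m where m: "m \<in> K" "\<And>w. w \<in> K \<Longrightarrow> norm (f w) \<le> norm (f m)"
    using continuous_attains_sup[of K "\<lambda>w. norm (f w)"] by blast
  have "norm (f w) \<le> norm (f m)" if w: "w \<in> annulus" for w
  proof -
    \<comment> \<open>One multiplication or division by \<open>q\<close> brings any other point of
      the annulus into \<open>K\<close>.\<close>
    consider "w \<in> K" | "norm w > 1 / r" | "norm w < r"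
      unfolding K_iff not_le[symmetric] by blast
    then show ?thesis
    proof cases
      case 1
      then show ?thesis by (rule m)
    next
      case 2
      have "r * r * norm w > r * r * (1 / r)"
        using 2 r by (intro mult_strict_left_mono) auto
      then have "norm (q * w) > r"
        using r by (simp add: norm_mult)
      moreover have "norm (q * w) < 1"
        using annulus_D[OF w] by simp
      ultimately have "q * w \<in> K"
        using r1 by (simp add: K_iff)
      moreover have "f (q * w) = f w"
        using 2 r1 \<open>norm (q * w) < 1\<close> by (intro per) auto
      ultimately show ?thesis
        using m(2)[of "q * w"] by simp
    next
      case 3
      have w1: "norm (w / q) > 1"
        using w q_nz by (simp add: annulus_def norm_divide field_simps)
      have "norm w / (r * r) < r / (r * r)"
        using 3 r by (intro divide_strict_right_mono) auto
      then have "norm (w / q) < 1 / r"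
        using r by (simp add: norm_divide)
      with w1 have "w / q \<in> K"
        using r by (simp add: K_iff)
      moreover have "f (q * (w / q)) = f (w / q)"
        using w1 3 r q_nz by (intro per) auto
      ultimately show ?thesis
        using m(2)[of "w / q"] q_nz by simp
    qed
  qed
  with m(1) sub show ?thesis
    by (intro maximum_modulus_principle[OF hol open_annulus connected_annulus_q open_annulus order_refl, of m])
      auto
qed

text \<open>The shift moves one term out of the first Lambert series into the central position, and
  the old central term into the second series.\<close>

lemma wp_shift:
  assumes "1 < norm w" "norm (q * w) < 1"
  shows "wp (q * w) = wp w"
proof -
  have w0: "w \<noteq> 0" "w \<noteq> 1"
    using assms by auto
  have "lambert w - lambert (q * w) = q * w / (1 - q * w)\<^sup>2"
    using assms by (intro lambert_shift)
  moreover have "lambert (1 / (q * w)) - lambert (1 / w) = (1 / w) / (1 - 1 / w)\<^sup>2"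
    using lambert_shift[of "1 / (q * w)"] assms w0 q_nz by (simp add: norm_divide)
  moreover have "(1 / w) / (1 - 1 / w)\<^sup>2 = w / (1 - w)\<^sup>2"
    using w0 by (simp add: field_simps power2_eq_square)
  ultimately show ?thesis
    unfolding wp_def by algebra
qed

text \<open>The denominator is \<open>(theta w)\<^sup>2\<close> without its factor
  \<open>(1 - w)\<^sup>2\<close>, so the quotient is regular on the whole annulus, the point 1
  included.\<close>

definition theta_quot :: "complex \<Rightarrow> complex \<Rightarrow> complex" where
  "theta_quot y w = theta (y * w) * theta (y / w) / (qpoch (q * w) * qpoch (q / w))\<^sup>2"

lemma qpoch_annulus_nonzero:
  assumes "w \<in> annulus"
  shows "qpoch (q * w) \<noteq> 0" "qpoch (q / w) \<noteq> 0"
  using annulus_D[OF assms] by (simp_all add: qpoch_nonzero)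

lemma theta_quot_holomorphic:
  assumes "y \<noteq> 0"
  shows "theta_quot y holomorphic_on annulus"
proof -
  have "(\<lambda>w. qpoch (y * w) * qpoch (q / (y * w)) * (qpoch (y / w) * qpoch (q / (y / w))) /
      (qpoch (q * w) * qpoch (q / w))\<^sup>2) holomorphic_on annulus"
    by (intro holomorphic_intros) (use assms annulus_D qpoch_annulus_nonzero in auto)
  then show ?thesis
    unfolding theta_quot_def[abs_def] theta_def .
qed

lemma theta_quot_inverse: "theta_quot y (1 / w) = theta_quot y w"
  unfolding theta_quot_def by (simp add: mult_ac)

lemma theta_quot_conv_theta:
  assumes "w \<noteq> 1"
  shows "w * theta_quot y w / (1 - w)\<^sup>2 = w * theta (y * w) * theta (y / w) / (theta w)\<^sup>2"
proof -
  have "theta w = (1 - w) * (qpoch (q * w) * qpoch (q / w))"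
    unfolding theta_def by (subst qpoch_shift) (simp add: mult_ac)
  then show ?thesis
    unfolding theta_quot_def by (simp add: power_mult_distrib mult_ac)
qed

text \<open>By \<open>theta_shift\<close> the numerator acquires \<open>1 / (q * w\<^sup>2)\<close>
  and the denominator \<open>1 / w\<^sup>2\<close>; the factor \<open>q\<close> of
  \<open>q * w\<close> cancels the rest.\<close>

lemma theta_quot_shift:
  assumes w: "1 < norm w" "norm (q * w) < 1" and y: "y \<noteq> 0"
  shows "q * w * theta_quot y (q * w) / (1 - q * w)\<^sup>2 = w * theta_quot y w / (1 - w)\<^sup>2"
proof -
  have w0: "w \<noteq> 0" "w \<noteq> 1" "q * w \<noteq> 1"
    using w by auto
  have "theta (y * (q * w)) = - theta (y * w) / (y * w)"
    using theta_shift[of "y * w"] w0 y by (simp add: mult_ac)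
  moreover have "theta (y / (q * w)) = - (y / (q * w)) * theta (y / w)"
    using theta_shift[of "y / (q * w)"] w0 y q_nz by (simp add: field_simps)
  moreover have "theta (q * w) = - theta w / w"
    using w0 by (intro theta_shift)
  ultimately have "q * w * theta (y * (q * w)) * theta (y / (q * w)) / (theta (q * w))\<^sup>2 =
      w * theta (y * w) * theta (y / w) / (theta w)\<^sup>2"
    using w0 y q_nz by (simp add: power2_eq_square)
  then show ?thesis
    using theta_quot_conv_theta w0 by simp
qed

lemma exists_shift_into_annulus:
  assumes "y \<noteq> 0"
  obtains k :: int where "y * q powi k \<in> annulus"
proof -
  define L where "L = ln (norm q)"
  have L: "L < 0"
    using norm_q q_nz by (simp add: L_def)
  \<comment> \<open>The logarithm of \<open>norm y\<close> to base \<open>norm q\<close>; rounding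
    it puts the exponent of \<open>norm (y * q powi k)\<close> in the interval from 0 to 1, with 1
    excluded.\<close>
  define t where "t = ln (norm y) / L"
  define k where "k = \<lceil>- t\<rceil>"
  have k: "0 \<le> t + of_int k" "t + of_int k < 1"
    unfolding k_def by linarith+
  have "norm q powi k = exp (of_int k * L)"
    using powr_real_of_int'[of "norm q" k] q_nz by (simp add: L_def powr_def)
  moreover have "norm y = exp (t * L)"
    using assms L by (simp add: t_def)
  ultimately have "norm (y * q powi k) = exp ((t + of_int k) * L)"
    by (simp add: norm_mult norm_power_int exp_add distrib_right)
  moreover have "1 * L < (t + of_int k) * L"
    using k L by (intro mult_strict_right_mono_neg) auto
  moreover have "(t + of_int k) * L < - L"
    using mult_right_mono_neg[OF k(1), of L] L by linarith
  moreover have "norm q = exp L" "1 / norm q = exp (- L)"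
    using q_nz by (simp_all add: L_def exp_minus divide_inverse)
  ultimately have "y * q powi k \<in> annulus"
    by (simp add: annulus_def)
  then show ?thesis ..
qed

text \<open>
  After removing its double pole at \<open>1\<close>, the difference of both sides is \<open>q\<close>-periodic, so its
  modulus attains a maximum on the open annulus; it vanishes at a translate of \<open>y\<close>.
  The simple pole at \<open>1\<close> is excluded by the symmetry \<open>w \<mapsto> 1 / w\<close>.
\<close>

lemma theta_quot_eq:
  assumes y0: "y \<noteq> 0" and y: "\<And>i. y * q powi i \<noteq> 1" and w: "w \<in> annulus"
  defines "P \<equiv> (\<Sum>\<^sub>\<infinity>i\<in>UNIV. y * q powi i / (1 - y * q powi i)\<^sup>2)"
  shows "theta_quot y w = (theta y)\<^sup>2 / qpoch q ^ 4 *
    (1 + (1 - w)\<^sup>2 / w * (lambert w + lambert (1 / w) - P))"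
proof -
  \<comment> \<open>The value of \<open>theta_quot y\<close> at 1, hence the coefficient of the
    double pole to be matched with \<open>c * wp w\<close>.\<close>
  define c where "c = (theta y)\<^sup>2 / qpoch q ^ 4"
  have T1: "theta_quot y 1 = c"
    by (simp add: theta_quot_def c_def power2_eq_square power4_eq_xxxx)
  \<comment> \<open>The difference of both sides multiplied by \<open>(1 - w)\<^sup>2 / w\<close>,
    with the constant \<open>P\<close> still left out.\<close>
  define E where "E w = theta_quot y w - c - c * ((1 - w)\<^sup>2 / w * (lambert w + lambert (1 / w)))" for w
  have lamb: "(\<lambda>w. lambert (f w)) holomorphic_on annulus"
    if "f holomorphic_on annulus" "\<And>w. w \<in> annulus \<Longrightarrow> f w \<in> annulus" for f
    using holomorphic_on_compose_gen[OF that(1) lambert_holomorphic] that(2) annulus_D(2)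
    unfolding o_def by auto
  have hol_E: "E holomorphic_on annulus"
    unfolding E_def
    by (intro holomorphic_intros lamb theta_quot_holomorphic[THEN holomorphic_on_compose_gen, unfolded o_def, of _ "\<lambda>w. w"])
      (use y0 annulus_D in auto)
  have E1: "E 1 = 0"
    by (simp add: E_def T1)
  have E_inv: "E (1 / w) = E w" if "w \<in> annulus" for w
  proof -
    have "(1 - 1 / w)\<^sup>2 / (1 / w) = (1 - w)\<^sup>2 / w"
      using annulus_D(1)[OF that] by (simp add: field_simps power2_eq_square)
    then show ?thesis
      by (simp add: E_def theta_quot_inverse add.commute)
  qed
  \<comment> \<open>Differentiating the symmetry at its fixed point 1 reverses the sign of the
    derivative. With \<open>E 1 = 0\<close> the zero at 1 is at least double.\<close>
  have dE: "deriv E 1 = 0"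
  proof -
    have d: "(E has_field_derivative deriv E 1) (at 1)"
      using hol_E open_annulus one_in_annulus by (rule holomorphic_derivI)
    have "((\<lambda>w. E (1 / w)) has_field_derivative deriv E 1 * (- 1)) (at 1)"
      by (rule DERIV_chain2[of E]) (use d in \<open>auto intro!: derivative_eq_intros\<close>)
    then have "(E has_field_derivative deriv E 1 * (- 1)) (at 1)"
      by (rule has_field_derivative_transform_within_open[OF _ open_annulus one_in_annulus]) (rule E_inv)
    from DERIV_unique[OF this d] show ?thesis
      by simp
  qed
  \<comment> \<open>Two divisions by \<open>w - 1\<close>, each with its removable singularity
    filled in, give a holomorphic extension of \<open>E w / (1 - w)\<^sup>2\<close>.\<close>
  define g1 where "g1 w = (if w = 1 then deriv E 1 else (E w - E 1) / (w - 1))" for w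
  define g2 where "g2 w = (if w = 1 then deriv g1 1 else (g1 w - g1 1) / (w - 1))" for w
  have hol1: "g1 holomorphic_on annulus"
    unfolding g1_def[abs_def] by (intro pole_lemma_open hol_E open_annulus)
  have hol2: "g2 holomorphic_on annulus"
    unfolding g2_def[abs_def] by (intro pole_lemma_open hol1 open_annulus)
  define J where "J w = w * g2 w" for w
  have hol_J: "J holomorphic_on annulus"
    unfolding J_def by (intro holomorphic_intros hol2)
  have J_eq: "J w = w * theta_quot y w / (1 - w)\<^sup>2 - c * wp w" if "w \<noteq> 0" "w \<noteq> 1" for w
  proof -
    have "g2 w = E w / (1 - w)\<^sup>2"
      using that by (simp add: g2_def g1_def E1 dE power2_eq_square) (simp add: field_simps)
    then have "J w = w * E w / (1 - w)\<^sup>2"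
      by (simp add: J_def)
    also have "\<dots> = w * theta_quot y w / (1 - w)\<^sup>2 - c * wp w"
      using that unfolding E_def wp_def by (simp add: field_simps)
    finally show ?thesis .
  qed
  have "J (q * w) = J w" if "1 < norm w" "norm (q * w) < 1" for w
  proof -
    have "w \<noteq> 0" "w \<noteq> 1" "q * w \<noteq> 0" "q * w \<noteq> 1"
      using that q_nz by auto
    then show ?thesis
      using theta_quot_shift[OF that y0] wp_shift[OF that] by (simp add: J_eq)
  qed
  then have "J constant_on annulus"
    by (intro annulus_periodic_constant hol_J)
  then obtain C where C: "\<And>w. w \<in> annulus \<Longrightarrow> J w = C"
    unfolding constant_on_def by blast
  \<comment> \<open>\<open>y\<close> itself may lie outside the annulus, where \<open>wp\<close>
    does not represent the bilateral sum; a translate \<open>x\<close> has the same sum after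
    reindexing.\<close>
  obtain k where k: "y * q powi k \<in> annulus"
    using exists_shift_into_annulus[OF y0] .
  define x where "x = y * q powi k"
  have x: "x \<noteq> 0" "x \<noteq> 1" "x \<in> annulus"
    using y[of k] y0 q_nz k by (auto simp: x_def)
  have "((\<lambda>i. x * q powi i / (1 - x * q powi i)\<^sup>2) has_sum wp x) UNIV"
    using annulus_D[OF x(3)] by (intro wp_has_sum)
  moreover have "x * q powi i = y * q powi (i + k)" for i
    using q_nz by (simp add: x_def power_int_add mult_ac)
  ultimately have "((\<lambda>i. y * q powi (i + k) / (1 - y * q powi (i + k))\<^sup>2) has_sum wp x) UNIV"
    by simp
  then have "((\<lambda>i. y * q powi i / (1 - y * q powi i)\<^sup>2) has_sum wp x) UNIV"
    by (subst (asm) has_sum_reindex_bij_betw[of "\<lambda>i. i + k" UNIV UNIV "\<lambda>i. y * q powi i / (1 - y * q powi i)\<^sup>2"])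
      (auto intro: bij_betwI[where g = "\<lambda>i. i - k"])
  then have P: "P = wp x"
    unfolding P_def by (rule infsumI)
  \<comment> \<open>At \<open>x\<close> the theta quotient vanishes, so the constant value of
    \<open>J\<close> is \<open>- c * wp x\<close>.\<close>
  have "theta (y / x) = 0"
    using y0 x_def by (rule theta_eq_0)
  then have "C = - c * P"
    using C[OF x(3)] J_eq[OF x(1,2)] P by (simp add: theta_quot_def)
  show ?thesis
  proof (cases "w = 1")
    case True
    then show ?thesis
      using T1 by (simp add: c_def)
  next
    case False
    have w0: "w \<noteq> 0"
      using annulus_D(1)[OF w] .
    have "w * theta_quot y w / (1 - w)\<^sup>2 = c * (w / (1 - w)\<^sup>2 + lambert w + lambert (1 / w) - P)"
      using C[OF w] J_eq[OF w0 False] \<open>C = - c * P\<close> by (simp add: wp_def algebra_simps)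
    moreover have "theta_quot y w = w * theta_quot y w / (1 - w)\<^sup>2 * ((1 - w)\<^sup>2 / w)"
      using w0 False by simp
    ultimately have "theta_quot y w = c * (w / (1 - w)\<^sup>2 + lambert w + lambert (1 / w) - P) * ((1 - w)\<^sup>2 / w)"
      by simp
    also have "\<dots> = c * (1 + (1 - w)\<^sup>2 / w * (lambert w + lambert (1 / w) - P))"
      using w0 False by (simp add: field_simps)
    finally show ?thesis
      by (simp add: c_def)
  qed
qed

subsection \<open>The sums \<open>s\<^sub>N\<close>\<close>

definition ssum :: "complex \<Rightarrow> nat \<Rightarrow> complex" where
  "ssum y N = (\<Sum>\<^sub>\<infinity>i\<in>(UNIV :: int set).
     1 / ((1 - y * q powi i) * (1 - 1 / y * q powi (int N - 1 - i))))"

text \<open>The deviation of \<open>ssum y N\<close> from \<open>N - 1\<close>; the linear part cancels in \<open>F_fun\<close>.\<close>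

definition sdev :: "complex \<Rightarrow> nat \<Rightarrow> complex" where
  "sdev y N = (if N = 0 then lcoeff 1 + 1
     else if N = 1 then - (\<Sum>\<^sub>\<infinity>i\<in>UNIV. y * q powi i / (1 - y * q powi i)\<^sup>2)
     else lcoeff (N - 1))"

lemma q_powi_ne_1: "k \<noteq> 0 \<Longrightarrow> q powi k \<noteq> 1"
proof
  assume k: "k \<noteq> 0" "q powi k = 1"
  obtain n where "k = int (Suc n) \<or> k = - int (Suc n)"
    using k(1) by (cases k rule: int_cases3) (auto simp: gr0_conv_Suc)
  then have "q ^ Suc n = 1"
    using k(2) q_nz by (auto simp: power_int_minus simp del: power_Suc of_nat_Suc)
  then show False
    using q_pow_ne_1 by blast
qed

text \<open>Partial fractions in \<open>v = y * q powi (i - M)\<close>; \<open>M \<noteq> 0\<close>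
  keeps the factor \<open>1 - q powi M\<close> nonzero.\<close>

lemma ssum_term:
  assumes y: "\<And>i. y * q powi i \<noteq> 1" and y0: "y \<noteq> 0" and M: "M \<noteq> 0"
  shows "1 / ((1 - y * q powi i) * (1 - 1 / y * q powi (M - i))) =
    1 / (1 - q powi M) * (1 / (1 - y * q powi i) - 1 / (1 - y * q powi (i - M)))"
proof -
  define u v where "u = y * q powi i" and "v = y * q powi (i - M)"
  have v0: "v \<noteq> 0"
    using y0 q_nz by (simp add: v_def)
  have uv: "u = v * q powi M" "1 / y * q powi (M - i) = 1 / v"
    using y0 q_nz by (simp_all add: u_def v_def power_int_diff field_simps)
  have ne: "v * q powi M \<noteq> 1" "v \<noteq> 1" "q powi M \<noteq> 1"
    using y[of i] y[of "i - M"] q_powi_ne_1[OF M] unfolding u_def[symmetric] v_def[symmetric] uv(1) by auto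
  have "1 / ((1 - v * w) * (1 - 1 / v)) = 1 / (1 - w) * (1 / (1 - v * w) - 1 / (1 - v))"
    if "v * w \<noteq> 1" "w \<noteq> 1" for w
    using that ne(2) v0 by (simp add: divide_simps) algebra
  from this[OF ne(1,3)] show ?thesis
    unfolding uv(2) u_def[symmetric] v_def[symmetric] uv(1) .
qed

text \<open>For \<open>N \<noteq> 1\<close> the telescoped value with \<open>M = N - 1\<close> is
  \<open>M / (1 - q powi M)\<close>. Subtracting \<open>M\<close> leaves a deviation that decays
  geometrically, which permits the later rearrangement of series.\<close>

lemma ssum_conv_sdev:
  assumes y: "\<And>i. y * q powi i \<noteq> 1" and y0: "y \<noteq> 0"
  shows "ssum y N = of_nat N - 1 + sdev y N"
proof -
  define f where "f i = 1 / (1 - y * q powi i)" for i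
  consider "N = 0" | "N = 1" | k where "N = Suc (Suc k)"
    by (metis One_nat_def nat.exhaust)
  then show ?thesis
  proof cases
    case 1
    \<comment> \<open>Here \<open>M = -1\<close>, so the shift runs in the opposite direction and
      the difference changes sign.\<close>
    have "((\<lambda>i. 1 / (1 - q powi (- 1)) * - (f (i + int 1) - f i)) has_sum
        (1 / (1 - q powi (- 1)) * - of_nat 1)) UNIV"
      unfolding f_def
      by (intro has_sum_cmult_right has_sum_uminus[THEN iffD2])
        (use has_sum_shift_difference[OF y y0, of 1] in simp)
    then have "ssum y N = 1 / (1 - q powi (- 1)) * - 1"
      unfolding ssum_def 1 using ssum_term[OF y y0, of "- 1"]
      by (intro infsumI) (simp add: f_def)
    moreover have "1 / (1 - q powi (- 1)) * - 1 = q / (1 - q)"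
    proof -
      have "q \<noteq> 1"
        using q_pow_ne_1[of 0] by simp
      then show ?thesis
        using q_nz by (simp add: power_int_minus field_simps)
    qed
    ultimately show ?thesis
      using 1 by (simp add: sdev_def lcoeff_def)
  next
    case 2
    have "1 / ((1 - y * q powi i) * (1 - 1 / y * q powi (int N - 1 - i))) =
        - (y * q powi i / (1 - y * q powi i)\<^sup>2)" for i
    proof -
      have u: "1 / y * q powi (int N - 1 - i) = 1 / (y * q powi i)"
        using y0 q_nz 2 by (simp add: power_int_minus field_simps)
      have "1 / ((1 - u) * (1 - 1 / u)) = - (u / (1 - u)\<^sup>2)" if "u \<noteq> 0" "u \<noteq> 1" for u :: complex
        using that by (simp add: divide_simps power2_eq_square) algebra
      from this[of "y * q powi i"] y[of i] y0 q_nz show ?thesis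
        unfolding u by simp
    qed
    then have "ssum y N = - (\<Sum>\<^sub>\<infinity>i\<in>UNIV. y * q powi i / (1 - y * q powi i)\<^sup>2)"
      unfolding ssum_def by (simp add: infsum_uminus)
    with 2 show ?thesis
      by (simp add: sdev_def)
  next
    case (3 k)
    have "((\<lambda>i. f (i + int (Suc k)) - f i) has_sum of_nat (Suc k)) UNIV"
      unfolding f_def by (rule has_sum_shift_difference[OF y y0])
    then have "((\<lambda>i. f i - f (i - int (Suc k))) has_sum of_nat (Suc k)) UNIV"
      by (subst has_sum_reindex_bij_betw[of "\<lambda>i. i + int (Suc k)" UNIV UNIV, symmetric])
        (auto intro: bij_betwI[where g = "\<lambda>i. i - int (Suc k)"])
    then have "((\<lambda>i. 1 / (1 - q powi int (Suc k)) * (f i - f (i - int (Suc k)))) has_sum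
        (1 / (1 - q powi int (Suc k)) * of_nat (Suc k))) UNIV"
      by (rule has_sum_cmult_right)
    moreover have "int N - 1 - i = int (Suc k) - i" for i
      using 3 by simp
    ultimately have "ssum y N = 1 / (1 - q powi int (Suc k)) * of_nat (Suc k)"
      unfolding ssum_def using ssum_term[OF y y0, of "int (Suc k)"]
      by (intro infsumI) (simp only: f_def)
    also have "\<dots> = of_nat (Suc k) + lcoeff (Suc k)"
      unfolding power_int_of_nat lcoeff_def using q_pow_ne_1[of k]
      by (simp add: divide_simps del: power_Suc of_nat_Suc) (simp add: algebra_simps)
    finally show ?thesis
      using 3 by (simp add: sdev_def)
  qed
qed

text \<open>The characters are bounded by a linear factor times \<open>R ^ m\<close>, and
  \<open>norm q * R < 1\<close> on the annulus; a quadratic polynomial times a geometric sequence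
  dominates the product.\<close>

lemma summable_su2_char_lcoeff:
  assumes w: "w \<in> annulus"
  shows "summable (\<lambda>m. su2_char (m + i) w * lcoeff (m + k))"
proof -
  define R where "R = max (norm w) (norm (1 / w))"
  have R: "norm w \<le> R" "norm (1 / w) \<le> R"
    by (auto simp: R_def)
  have R0: "0 \<le> R"
    by (rule order_trans[OF norm_ge_zero R(1)])
  have "norm q * R < 1"
    using annulus_D[OF w] by (auto simp: R_def max_def norm_mult norm_divide)
  then have s: "norm (norm q * R) < 1"
    using R0 by simp
  define C where "C = R ^ i * norm q ^ k / (1 - norm q)"
  have "summable (\<lambda>m. C * (real m ^ 2 * (norm q * R) ^ m) + C * real (i + 1 + k) * (real m ^ 1 * (norm q * R) ^ m)
      + C * real ((i + 1) * k) * (real m ^ 0 * (norm q * R) ^ m))"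
    by (intro summable_add summable_mult summable_power_mult_geometric s)
  then show ?thesis
  proof (rule summable_comparison_test')
    fix m
    have "norm (su2_char (m + i) w * lcoeff (m + k)) \<le>
        (real (Suc (m + i)) * R ^ (m + i)) * (real (m + k) * norm q ^ (m + k) / (1 - norm q))"
      unfolding norm_mult using annulus_D(1)[OF w] R R0 norm_q
      by (intro mult_mono norm_su2_char_le norm_lcoeff_le mult_nonneg_nonneg) auto
    also have "\<dots> = C * (real m ^ 2 * (norm q * R) ^ m) + C * real (i + 1 + k) * (real m ^ 1 * (norm q * R) ^ m)
      + C * real ((i + 1) * k) * (real m ^ 0 * (norm q * R) ^ m)"
      by (simp add: C_def power_add power_mult_distrib add_divide_distrib power2_eq_square algebra_simps)
    finally show "norm (su2_char (m + i) w * lcoeff (m + k)) \<le>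
      C * (real m ^ 2 * (norm q * R) ^ m) + C * real (i + 1 + k) * (real m ^ 1 * (norm q * R) ^ m)
      + C * real ((i + 1) * k) * (real m ^ 0 * (norm q * R) ^ m)" .
  qed
qed

text \<open>
  Summation by parts moves the differences from \<open>ssum\<close> to the characters, where they collapse
  to \<open>(1 - w)\<^sup>2 / w * (w\<^sup>M + w\<^sup>-\<^sup>M)\<close>.
\<close>

lemma su2_char_ssum_sums:
  assumes y: "\<And>i. y * q powi i \<noteq> 1" and y0: "y \<noteq> 0" and w: "w \<in> annulus"
  shows "(\<lambda>N. su2_char N w * (ssum y N - 2 * ssum y (N + 1) + 2 * ssum y (N + 3) - ssum y (N + 4))) sums
    (1 + (1 - w)\<^sup>2 / w * (lambert w + lambert (1 / w) - (\<Sum>\<^sub>\<infinity>i\<in>UNIV. y * q powi i / (1 - y * q powi i)\<^sup>2)))"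
proof -
  define P where "P = (\<Sum>\<^sub>\<infinity>i\<in>UNIV. y * q powi i / (1 - y * q powi i)\<^sup>2)"
  define \<kappa> where "\<kappa> = (1 - w)\<^sup>2 / w"
  have w0: "w \<noteq> 0"
    using annulus_D(1)[OF w] .
  have \<kappa>: "\<kappa> = w + 1 / w - 2"
    using w0 by (simp add: \<kappa>_def field_simps power2_eq_square)
  \<comment> \<open>The common tails: all four series are aligned on the same
    \<open>lcoeff (m + 3)\<close>, and only the index of the character varies.\<close>
  define X where "X i = (\<Sum>m. su2_char (m + i) w * lcoeff (m + 3))" for i
  have X: "(\<lambda>m. su2_char (m + i) w * lcoeff (m + 3)) sums X i" for i
    unfolding X_def by (intro summable_sums summable_su2_char_lcoeff w)
  have dev: "sdev y (m + 4) = lcoeff (m + 3)" for m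
    by (simp add: sdev_def add.commute)
  \<comment> \<open>Exactly \<open>i\<close> initial terms are split off, so that the argument of
    \<open>sdev\<close> starts at 4, beyond the exceptional values at 0 and 1.\<close>
  have Y: "(\<lambda>N. su2_char N w * sdev y (N + j)) sums
      (X i + (\<Sum>N<i. su2_char N w * sdev y (N + j)))" if "i + j = 4" for i j
  proof -
    have "m + i + j = m + 4" for m
      using that by simp
    then have "(\<lambda>m. su2_char (m + i) w * sdev y (m + i + j)) sums X i"
      using X[of i] by (simp only: dev)
    then show ?thesis
      by (subst (asm) sums_iff_shift)
  qed
  have total: "(\<lambda>N. su2_char N w * sdev y (N + 0) - 2 * (su2_char N w * sdev y (N + 1))
      + 2 * (su2_char N w * sdev y (N + 3)) - su2_char N w * sdev y (N + 4)) sums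
    (X 4 + (\<Sum>N<4. su2_char N w * sdev y (N + 0)) - 2 * (X 3 + (\<Sum>N<3. su2_char N w * sdev y (N + 1)))
      + 2 * (X 1 + (\<Sum>N<1. su2_char N w * sdev y (N + 3))) - (X 0 + (\<Sum>N<0. su2_char N w * sdev y (N + 4))))"
    by (intro sums_add sums_diff sums_mult Y) simp_all
  have "(\<lambda>m. \<kappa> * (lcoeff m * w ^ m + lcoeff m * (1 / w) ^ m)) sums (\<kappa> * (lambert w + lambert (1 / w)))"
    using annulus_D[OF w] annulus_D(2)[OF annulus_D(4)[OF w]]
    by (intro sums_mult sums_add lambert_sums)
  then have "(\<lambda>m. \<kappa> * (lcoeff (m + 3) * w ^ (m + 3) + lcoeff (m + 3) * (1 / w) ^ (m + 3))) sums
      (\<kappa> * (lambert w + lambert (1 / w)) - (\<Sum>m<3. \<kappa> * (lcoeff m * w ^ m + lcoeff m * (1 / w) ^ m)))"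
    by (rule sums_split_initial_segment)
  moreover have "\<kappa> * (lcoeff (m + 3) * w ^ (m + 3) + lcoeff (m + 3) * (1 / w) ^ (m + 3)) =
      su2_char (m + 4) w * lcoeff (m + 3) - 2 * (su2_char (m + 3) w * lcoeff (m + 3))
      + 2 * (su2_char (m + 1) w * lcoeff (m + 3)) - su2_char (m + 0) w * lcoeff (m + 3)" for m
  proof -
    have "\<kappa> * (lcoeff (m + 3) * w ^ (m + 3) + lcoeff (m + 3) * (1 / w) ^ (m + 3)) =
        (\<kappa> * (w ^ (m + 3) + (1 / w) ^ (m + 3))) * lcoeff (m + 3)"
      by (simp only: ring_distribs mult_ac)
    also have "\<dots> = (su2_char (m + 4) w - 2 * su2_char (m + 3) w + 2 * su2_char (m + 1) w - su2_char m w) * lcoeff (m + 3)"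
      unfolding \<kappa>_def su2_char_combination[OF w0] ..
    finally show ?thesis
      by (simp only: ring_distribs mult_ac add_0_right)
  qed
  moreover have "(\<lambda>m. su2_char (m + 4) w * lcoeff (m + 3) - 2 * (su2_char (m + 3) w * lcoeff (m + 3))
      + 2 * (su2_char (m + 1) w * lcoeff (m + 3)) - su2_char (m + 0) w * lcoeff (m + 3)) sums
      (X 4 - 2 * X 3 + 2 * X 1 - X 0)"
    by (intro sums_add sums_diff sums_mult X)
  ultimately have XX: "X 4 - 2 * X 3 + 2 * X 1 - X 0 =
      \<kappa> * (lambert w + lambert (1 / w)) - (\<Sum>m<3. \<kappa> * (lcoeff m * w ^ m + lcoeff m * (1 / w) ^ m))"
    using sums_unique2 by (simp only:)
  \<comment> \<open>The low characters are polynomials in the trace \<open>t\<close>, which reduces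
    the finite boundary terms to a polynomial identity.\<close>
  define t where "t = w + 1 / w"
  have chi: "su2_char 0 w = 1" "su2_char 1 w = t" "su2_char 2 w = t\<^sup>2 - 1" "su2_char 3 w = t ^ 3 - 2 * t"
    "w\<^sup>2 + (1 / w)\<^sup>2 = t\<^sup>2 - 2"
    using su2_char_Suc_Suc[OF w0, of 0] su2_char_Suc_Suc[OF w0, of 1] w0
    by (simp_all add: su2_char_0 su2_char_1 t_def numeral_eq_Suc field_simps)
  have devs: "sdev y 0 = lcoeff 1 + 1" "sdev y 1 = - P" "sdev y 2 = lcoeff 1" "sdev y 3 = lcoeff 2"
    by (simp_all add: sdev_def P_def)
  have l0: "lcoeff 0 = 0"
    by (simp add: lcoeff_def)
  have sums3: "(\<Sum>m<3. f m) = f 0 + f 1 + f 2" "(\<Sum>m<4. f m) = f 0 + f 1 + f 2 + f 3" for f :: "nat \<Rightarrow> complex"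
    by (simp_all add: numeral_eq_Suc)
  have "X 4 + (\<Sum>N<4. su2_char N w * sdev y (N + 0)) - 2 * (X 3 + (\<Sum>N<3. su2_char N w * sdev y (N + 1)))
      + 2 * (X 1 + (\<Sum>N<1. su2_char N w * sdev y (N + 3))) - (X 0 + (\<Sum>N<0. su2_char N w * sdev y (N + 4))) =
      (X 4 - 2 * X 3 + 2 * X 1 - X 0) + (lcoeff 1 + 1 - t * P + (t\<^sup>2 - 1) * lcoeff 1 + (t ^ 3 - 2 * t) * lcoeff 2
        - 2 * (- P + t * lcoeff 1 + (t\<^sup>2 - 1) * lcoeff 2) + 2 * lcoeff 2)"
    unfolding sums3 by (simp add: chi devs chi(2)[unfolded One_nat_def] devs(2)[unfolded One_nat_def]
        devs(3)[unfolded numeral_2_eq_2 One_nat_def] devs(4)[unfolded numeral_3_eq_3] algebra_simps)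
  also have "X 4 - 2 * X 3 + 2 * X 1 - X 0 =
      \<kappa> * (lambert w + lambert (1 / w)) - \<kappa> * (lcoeff 1 * t + lcoeff 2 * (t\<^sup>2 - 2))"
    unfolding XX sums3 chi(5)[symmetric] by (simp add: l0 t_def algebra_simps)
  \<comment> \<open>The terms in \<open>lcoeff 1\<close> and \<open>lcoeff 2\<close> cancel. The
    summand 1 comes from \<open>sdev y 0\<close>, and \<open>P\<close> receives
    \<open>2 - t = - \<kappa>\<close> from \<open>sdev y 1\<close>.\<close>
  also have "\<kappa> * (lambert w + lambert (1 / w)) - \<kappa> * (lcoeff 1 * t + lcoeff 2 * (t\<^sup>2 - 2)) +
      (lcoeff 1 + 1 - t * P + (t\<^sup>2 - 1) * lcoeff 1 + (t ^ 3 - 2 * t) * lcoeff 2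
        - 2 * (- P + t * lcoeff 1 + (t\<^sup>2 - 1) * lcoeff 2) + 2 * lcoeff 2) =
      1 + \<kappa> * (lambert w + lambert (1 / w) - P)"
    unfolding \<kappa> t_def[symmetric] by algebra
  finally have total_eq: "X 4 + (\<Sum>N<4. su2_char N w * sdev y (N + 0)) - 2 * (X 3 + (\<Sum>N<3. su2_char N w * sdev y (N + 1)))
      + 2 * (X 1 + (\<Sum>N<1. su2_char N w * sdev y (N + 3))) - (X 0 + (\<Sum>N<0. su2_char N w * sdev y (N + 4))) =
      1 + \<kappa> * (lambert w + lambert (1 / w) - P)" .
  have "su2_char N w * (ssum y N - 2 * ssum y (N + 1) + 2 * ssum y (N + 3) - ssum y (N + 4)) =
      su2_char N w * sdev y (N + 0) - 2 * (su2_char N w * sdev y (N + 1))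
      + 2 * (su2_char N w * sdev y (N + 3)) - su2_char N w * sdev y (N + 4)" for N
    unfolding ssum_conv_sdev[OF y y0] by (simp add: algebra_simps)
  then show ?thesis
    using total unfolding total_eq \<kappa>_def P_def by simp
qed

subsection \<open>Product formulas\<close>

lemma qpoch_has_prod_Suc: "(\<lambda>n. 1 - x * q ^ Suc n) has_prod qpoch (q * x)"
  using qpoch_has_prod[of "q * x"] by (simp add: mult_ac)

lemma theta_quot_has_prod:
  assumes "w \<in> annulus" "y \<noteq> 0"
  shows "(\<lambda>n. ((1 - y / w * q ^ n) * (1 - w / y * q ^ Suc n) *
      (1 - 1 / (y * w) * q ^ Suc n) * (1 - y * w * q ^ n)) /
      ((1 - w * q ^ Suc n)\<^sup>2 * (1 - 1 / w * q ^ Suc n)\<^sup>2)) has_prod theta_quot y w"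
proof -
  have "(\<lambda>n. ((1 - y / w * q ^ n) * (1 - w / y * q ^ Suc n) *
      (1 - 1 / (y * w) * q ^ Suc n) * (1 - y * w * q ^ n)) /
      ((1 - w * q ^ Suc n)\<^sup>2 * (1 - 1 / w * q ^ Suc n)\<^sup>2)) has_prod
    (qpoch (y / w) * qpoch (q * (w / y)) * qpoch (q * (1 / (y * w))) * qpoch (y * w) /
      ((qpoch (q * w))\<^sup>2 * (qpoch (q * (1 / w)))\<^sup>2))"
    unfolding power2_eq_square
    using qpoch_annulus_nonzero[OF assms(1)]
    by (intro has_prod_divide has_prod_mult qpoch_has_prod qpoch_has_prod_Suc)
  then show ?thesis
    by (simp add: theta_quot_def theta_def power_mult_distrib mult_ac)
qed

text \<open>The exterior factors give the numerator. The splitting is self-dual, so both symmetric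
  factors give the same product, whence the squares in the denominator.\<close>

lemma ch_E_conv_theta_quot:
  assumes q: "q = nome \<tau>" and y: "y = yvar z" and w: "w \<in> annulus"
  shows "ch_E \<tau> z UNIV (split_roots w) = theta_quot y w"
proof -
  have w0: "w \<noteq> 0" and small: "norm (q * w) < 1" "norm (q / w) < 1"
    using annulus_D[OF w] by auto
  have y0: "y \<noteq> 0"
    by (simp add: y yvar_def)
  have bound: "norm (q ^ Suc n * w) < 1" "norm (q ^ Suc n / w) < 1" for n
    using norm_q_pow_mult_le[of n "q * w"] norm_q_pow_mult_le[of n "q / w"] small
    by (simp_all add: mult_ac)
  have L1: "(\<lambda>n. ch_Lambda (- y * q ^ n) UNIV (split_roots w)) has_prod (qpoch (y * w) * qpoch (y / w))"
  proof -
    have "ch_Lambda (- y * q ^ n) UNIV (split_roots w) = (1 - y * w * q ^ n) * (1 - y / w * q ^ n)" for n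
      using w0 by (simp add: ch_Lambda_split_roots mult_ac)
    then show ?thesis
      by (simp only:) (intro has_prod_mult qpoch_has_prod)
  qed
  have L2: "(\<lambda>n. ch_Lambda (- (1 / y) * q ^ Suc n) UNIV (split_roots (1 / w))) has_prod
      (qpoch (q * (1 / (y * w))) * qpoch (q * (w / y)))"
  proof -
    have "ch_Lambda (- (1 / y) * q ^ Suc n) UNIV (split_roots (1 / w)) =
        (1 - 1 / (y * w) * q ^ Suc n) * (1 - w / y * q ^ Suc n)" for n
      using w0 by (simp add: ch_Lambda_split_roots mult_ac)
    then show ?thesis
      by (simp only:) (intro has_prod_mult qpoch_has_prod_Suc)
  qed
  have S: "(\<lambda>n. 1 / ((1 - w * q ^ Suc n) * (1 - 1 / w * q ^ Suc n))) has_prod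
      (1 / (qpoch (q * w) * qpoch (q * (1 / w))))"
    using qpoch_annulus_nonzero[OF w]
    by (intro has_prod_divide has_prod_mult qpoch_has_prod_Suc has_prod_one)
  have S1: "ch_S (q ^ Suc n) UNIV (split_roots w) = 1 / ((1 - w * q ^ Suc n) * (1 - 1 / w * q ^ Suc n))" for n
    using ch_S_split_roots[OF w0 bound] by (simp add: mult_ac)
  have S2: "ch_S (q ^ Suc n) UNIV (split_roots (1 / w)) = 1 / ((1 - w * q ^ Suc n) * (1 - 1 / w * q ^ Suc n))" for n
    using ch_S_split_roots[of "1 / w" "q ^ Suc n"] w0 bound[of n] by (simp add: mult_ac)
  have "ch_E \<tau> z UNIV (split_roots w) =
      (qpoch (y * w) * qpoch (y / w)) * (qpoch (q * (1 / (y * w))) * qpoch (q * (w / y))) *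
      (1 / (qpoch (q * w) * qpoch (q * (1 / w)))) * (1 / (qpoch (q * w) * qpoch (q * (1 / w))))"
    unfolding ch_E_def split_roots_dual q[symmetric] y[symmetric] S1 S2
      has_prod_unique[OF L1, symmetric] has_prod_unique[OF L2, symmetric] has_prod_unique[OF S, symmetric] ..
  then show ?thesis
    by (simp add: theta_quot_def theta_def power2_eq_square mult_ac)
qed

text \<open>The factor \<open>theta1 / dedekind_eta ^ 3\<close> enters twice, once through
  \<open>s_fun\<close>; squaring it turns the half-integral power of \<open>y\<close> into
  \<open>1 / y\<close> and \<open>\<i>\<close> into a sign that cancels the outer minus.\<close>

lemma F_fun_conv_ssum:
  assumes q: "q = nome \<tau>" and y: "y = yvar z"
  shows "F_fun N \<tau> z = 1 / y * ((theta y)\<^sup>2 / qpoch q ^ 4) *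
    (ssum y N - 2 * ssum y (N + 1) + 2 * ssum y (N + 3) - ssum y (N + 4))"
proof -
  define \<rho> where "\<rho> = theta1 \<tau> z / dedekind_eta \<tau> ^ 3"
  define e where "e = exp (2 * of_real pi * \<i> * \<tau> / 24)"
  have pq: "(\<lambda>n. 1 - q ^ Suc n) has_prod qpoch q"
    using qpoch_has_prod_Suc[of 1] by simp
  have "(\<lambda>n. (1 - q ^ Suc n) * (1 - y * q ^ n) * (1 - 1 / y * q ^ Suc n)) has_prod
      (qpoch q * qpoch y * qpoch (q * (1 / y)))"
    by (intro has_prod_mult pq qpoch_has_prod qpoch_has_prod_Suc)
  then have "(\<Prod>n. (1 - q ^ Suc n) * (1 - q ^ n * y) * (1 - q ^ Suc n / y)) = qpoch q * theta y"
    by (intro has_prod_unique[symmetric]) (simp add: theta_def mult_ac)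
  then have th: "theta1 \<tau> z = \<i> * exp (2 * of_real pi * \<i> * \<tau> / 8) * exp (- (of_real pi * \<i> * z)) * (qpoch q * theta y)"
    unfolding theta1_def q[symmetric] y[symmetric] by simp
  have et: "dedekind_eta \<tau> = e * qpoch q"
    unfolding dedekind_eta_def q[symmetric] e_def using has_prod_unique[OF pq] by simp
  \<comment> \<open>The fractional powers of the nome in \<open>theta1\<close> and in the cube of
    \<open>dedekind_eta\<close> agree and cancel.\<close>
  have e3: "exp (2 * of_real pi * \<i> * \<tau> / 8) = e ^ 3"
    unfolding e_def by (subst exp_of_nat_mult[symmetric]) simp
  have ey: "(exp (- (of_real pi * \<i> * z)))\<^sup>2 = 1 / y"
    unfolding y yvar_def by (subst exp_of_nat_mult[symmetric]) (simp add: exp_minus inverse_eq_divide mult_ac)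
  have ne: "e \<noteq> 0" "qpoch q \<noteq> 0"
    using norm_q by (simp_all add: e_def qpoch_nonzero)
  have "\<rho> = \<i> * exp (- (of_real pi * \<i> * z)) * (theta y / (qpoch q)\<^sup>2)"
    unfolding \<rho>_def th et e3 using ne by (simp add: field_simps power2_eq_square power3_eq_cube)
  then have "\<rho>\<^sup>2 = - ((exp (- (of_real pi * \<i> * z)))\<^sup>2 * ((theta y)\<^sup>2 / qpoch q ^ 4))"
    by (simp add: power_mult_distrib power_divide)
  then have \<rho>2: "- \<rho>\<^sup>2 = 1 / y * ((theta y)\<^sup>2 / qpoch q ^ 4)"
    unfolding ey by simp
  have "s_fun N \<tau> z = \<rho> * ssum y N" for N
    unfolding s_fun_def ssum_def \<rho>_def q[symmetric] y[symmetric] ..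
  then have "F_fun N \<tau> z = - \<rho>\<^sup>2 * (ssum y N - 2 * ssum y (N + 1) + 2 * ssum y (N + 3) - ssum y (N + 4))"
    unfolding F_fun_def \<rho>_def[symmetric] by (simp add: algebra_simps power2_eq_square)
  then show ?thesis
    unfolding \<rho>2 .
qed

end

section \<open>Passage from \<open>\<tau>\<close> and \<open>z\<close> to \<open>q\<close> and
  \<open>y\<close>\<close>

lemma nome_disc_nome:
  assumes "Im \<tau> > 0"
  shows "nome_disc (nome \<tau>)"
proof
  show "nome \<tau> \<noteq> 0"
    by (simp add: nome_def)
  show "norm (nome \<tau>) < 1"
    using assms by (simp add: nome_def norm_exp_eq_Re)
qed

text \<open>The kernel of \<open>exp (2 * of_real pi * \<i> * u)\<close> in \<open>u\<close> is the
  integers, so equality would put \<open>z\<close> in the lattice.\<close>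

lemma yvar_mult_nome_ne_1:
  assumes "z \<notin> {of_int m + of_int n * \<tau> | m n. True}"
  shows "yvar z * nome \<tau> powi k \<noteq> 1"
proof
  assume "yvar z * nome \<tau> powi k = 1"
  then have "exp (2 * of_real pi * \<i> * (z + of_int k * \<tau>)) = 1"
    by (simp add: yvar_def nome_def exp_power_int exp_add[symmetric] algebra_simps)
  then obtain n :: int where "2 * of_real pi * \<i> * (z + of_int k * \<tau>) = 2 * of_real pi * \<i> * of_int n"
    using exp_eq[of "2 * of_real pi * \<i> * (z + of_int k * \<tau>)" 0] by (auto simp: mult_ac)
  then have "z + of_int k * \<tau> = of_int n"
    by simp
  then have "z = of_int n + of_int (- k) * \<tau>"
    by (simp add: algebra_simps)
  with assms show False
    by blast
qed

theorem mainTheorem3: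
  fixes \<tau> z q y \<zeta> :: complex
  assumes tau: "Im \<tau> > 0"
    and q_def: "q = nome \<tau>"
    and y_def: "y = yvar z"
    and z_notin: "z \<notin> {of_int m + of_int n * \<tau> | m n. True}"
    and zeta_gt: "norm q < norm \<zeta>"
    and zeta_lt: "norm \<zeta> < 1 / norm q"
  shows "let L = 1 / y *
                 (\<Prod>n. ((1 - y / \<zeta> * q ^ n) * (1 - \<zeta> / y * q ^ Suc n) *
                        (1 - 1 / (y * \<zeta>) * q ^ Suc n) * (1 - y * \<zeta> * q ^ n)) /
                       ((1 - \<zeta> * q ^ Suc n)\<^sup>2 * (1 - 1 / \<zeta> * q ^ Suc n)\<^sup>2))
         in (\<lambda>N. su2_char N \<zeta> * F_fun N \<tau> z) sums L \<and>
            L = 1 / y * ch_E \<tau> z UNIV (split_roots \<zeta>) \<and>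
            (\<forall>N. su2_char N \<zeta> = ch_sym N UNIV (split_roots \<zeta>))"
proof -
  interpret nome_disc q
    unfolding q_def using tau by (rule nome_disc_nome)
  have y0: "y \<noteq> 0"
    by (simp add: y_def yvar_def)
  have y_ne: "y * q powi i \<noteq> 1" for i
    unfolding y_def q_def using z_notin by (rule yvar_mult_nome_ne_1)
  have w: "\<zeta> \<in> annulus"
    using zeta_gt zeta_lt by (simp add: annulus_def)
  define P where "P = (\<Sum>\<^sub>\<infinity>i\<in>UNIV. y * q powi i / (1 - y * q powi i)\<^sup>2)"
  define B where "B N = ssum y N - 2 * ssum y (N + 1) + 2 * ssum y (N + 3) - ssum y (N + 4)" for N
  have "(\<lambda>N. 1 / y * ((theta y)\<^sup>2 / qpoch q ^ 4) * (su2_char N \<zeta> * B N)) sums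
      (1 / y * ((theta y)\<^sup>2 / qpoch q ^ 4) *
        (1 + (1 - \<zeta>)\<^sup>2 / \<zeta> * (lambert \<zeta> + lambert (1 / \<zeta>) - P)))"
    unfolding B_def P_def by (intro sums_mult su2_char_ssum_sums y_ne y0 w)
  moreover have "1 / y * ((theta y)\<^sup>2 / qpoch q ^ 4) * (su2_char N \<zeta> * B N) = su2_char N \<zeta> * F_fun N \<tau> z" for N
    unfolding F_fun_conv_ssum[OF q_def y_def] B_def by (simp only: mult_ac)
  \<comment> \<open>The prefactor of \<open>F_fun\<close> is \<open>1 / y\<close> times the constant
    \<open>c\<close> of the Weierstrass identity, so the sum of the series is the theta quotient
    over \<open>y\<close>.\<close>
  moreover have "1 / y * ((theta y)\<^sup>2 / qpoch q ^ 4) *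
      (1 + (1 - \<zeta>)\<^sup>2 / \<zeta> * (lambert \<zeta> + lambert (1 / \<zeta>) - P)) = 1 / y * theta_quot y \<zeta>"
    unfolding theta_quot_eq[OF y0 y_ne w] P_def by (simp only: mult_ac)
  ultimately have "(\<lambda>N. su2_char N \<zeta> * F_fun N \<tau> z) sums (1 / y * theta_quot y \<zeta>)"
    by simp
  then show ?thesis
    unfolding Let_def has_prod_unique[OF theta_quot_has_prod[OF w y0], symmetric]
      ch_E_conv_theta_quot[OF q_def y_def w]
    using ch_sym_split_roots[OF annulus_D(1)[OF w]] by simp
qed

end
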